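(* Assume that $\Omega$ is nonempty and compact, that $\Omega\subseteq\Delta=[-1,1]^n$, and that $q_i(x)>0$ for all $x\in\Omega$ and all $i=1,\dots,m$. For each integer $k\ge\max_{i,j}\lceil\deg(h_{i,j})/2\rceil$, let $\rho_k^*$ be the infimum of $\int_\Delta\phi(x)\,d\lambda(x)$ over all tuples $(\phi,\sigma_0,(\sigma_{i,j}))$ satisfying: $\phi\in\mathbb{R}[x]$ with $\deg\phi\le 2k$; $\sigma_0,\sigma_{i,j}\in\Sigma^2[x,y,z]$ for $i=1,\dots,4$, $j\in J_i$; $$\phi(x)-z=\sigma_0+\sum_{i=1}^4\sum_{j\in J_i}\sigma_{i,j}h_{i,j};$$ and $\deg(\sigma_0)\le 2k$, $\deg(\sigma_{i,j}h_{i,j})\le 2k$ for all $i=1,\dots,4$, $j\in J_i$. Then $$\lim_{k\to\infty}\rho_k^*=\int_\Delta\tilde\psi(x)\,d\lambda(x).$$ Consequently, if for each such $k$ the tuple $(\psi_k,\sigma_0^{(k)},(\sigma_{i,j}^{(k)}))$ is a nearly optimal (feasible) solution of this problem, e.g., $\int_\Delta\psi_k\,d\lambda\le\rho_k^*+1/k$, then $\psi_k(x)\ge\tilde\psi(x)$ for all $x\in\Delta$ and $$\lim_{k\to\infty}\int_\Delta|\psi_k(x)-\tilde\psi(x)|\,d\lambda(x)=0.$$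
   Context: Let $p_1,\dots,p_m,q_1,\dots,q_m,g_1,\dots,g_r\in\mathbb{R}[x]$ be real polynomials in $x=(x_1,\dots,x_n)$, and let $\Omega=\{x\in\mathbb{R}^n: g_j(x)\ge 0,\ j=1,\dots,r\}$. $\Sigma^2[\cdot]$ denotes the set of sums of squares of real polynomials in the indicated variables. $\lambda$ is the scaled Lebesgue measure $d\lambda(x)=dx/2^n$ on $\Delta$. For each $i$, $f_i^{\mathrm{lower}}$ and $f_i^{\mathrm{upper}}$ are fixed real numbers such that both $p_i-f_i^{\mathrm{lower}}q_i$ and $f_i^{\mathrm{upper}}q_i-p_i$ can be written in the form $\sigma_0+\sum_{j=1}^r\sigma_jg_j+\sum_{j=1}^n\sigma_{r+j}(1-x_j^2)$ with all $\sigma$'s in $\Sigma^2[x]$. Put $f^{\mathrm{lower}}=\min_if_i^{\mathrm{lower}}$ and $f^{\mathrm{upper}}=\max_if_i^{\mathrm{upper}}$, so that $f^{\mathrm{lower}}\le p_i/q_i\le f^{\mathrm{upper}}$ on $\Omega$ for all $i$. For $x\in\Delta$, $\tilde\psi(x)$ is the maximum of $z$ over all $(y,z)\in\mathbb{R}^n\times\mathbb{R}$ such that $p_i(x)q_i(y)-p_i(y)q_i(x)-zq_i(x)q_i(y)\ge 0$ for $i=1,\dots,m$, $y\in\Omega$, and $z\in[f^{\mathrm{lower}}-f^{\mathrm{upper}},f^{\mathrm{upper}}-f^{\mathrm{lower}}]$. The polynomials $h_{i,j}\in\mathbb{R}[x,y,z]$, with $x=(x_1,\dots,x_n)$, $y=(y_1,\dots,y_n)$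 and $z$ a single variable, are: - $h_{1,j}=p_j(x)q_j(y)-p_j(y)q_j(x)-zq_j(x)q_j(y)$ for $j\in J_1=\{1,\dots,m\}$; - $h_{2,j}=g_j(y)$ for $j=1,\dots,r$ and $h_{2,r+j}=1-y_j^2$ for $j=1,\dots,n$, with $J_2=\{1,\dots,r+n\}$; - $h_{3,j}=1-x_j^2$ for $j\in J_3=\{1,\dots,n\}$; - $h_{4,1}=(f^{\mathrm{upper}}-f^{\mathrm{lower}})^2-z^2$, with $J_4=\{1\}$.
   Formalization: It is additionally assumed that for every x in Δ the feasible set of (y,z) defining ψ̃(x) is nonempty; this does not follow from the other hypotheses, and without it the maximum ψ̃(x) is undefined on a set of positive measure. *)

theory Defs
  imports "HOL-Analysis.Analysis" "HOL-Library.Poly_Mapping"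
begin

section \<open>Multivariate real polynomials\<close>

text \<open>
  A polynomial is a finitely supported family of real coefficients indexed by finitely
  supported exponent vectors; the ring operations are those of \<^theory>\<open>HOL-Library.Poly_Mapping\<close>.
\<close>

type_synonym 'v rpoly = "('v \<Rightarrow>\<^sub>0 nat) \<Rightarrow>\<^sub>0 real"

definition Const :: "real \<Rightarrow> 'v rpoly" where
  "Const c = Poly_Mapping.single 0 c"

definition Var :: "'v \<Rightarrow> 'v rpoly" where
  "Var v = Poly_Mapping.single (Poly_Mapping.single v 1) 1"

definition eval :: "'v rpoly \<Rightarrow> ('v \<Rightarrow> real) \<Rightarrow> real" where
  "eval p a = (\<Sum>e\<in>Poly_Mapping.keys p. Poly_Mapping.lookup p e *
                 (\<Prod>v\<in>Poly_Mapping.keys e. a v ^ Poly_Mapping.lookup e v))"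

definition subst :: "('v \<Rightarrow> 'w rpoly) \<Rightarrow> 'v rpoly \<Rightarrow> 'w rpoly" where
  "subst s p = (\<Sum>e\<in>Poly_Mapping.keys p. Const (Poly_Mapping.lookup p e) *
                  (\<Prod>v\<in>Poly_Mapping.keys e. s v ^ Poly_Mapping.lookup e v))"

text \<open>Total degree, with the convention that the zero polynomial has degree 0.\<close>

definition deg :: "'v rpoly \<Rightarrow> nat" where
  "deg p = Max (insert 0 ((\<lambda>e. \<Sum>v\<in>Poly_Mapping.keys e. Poly_Mapping.lookup e v)
                            ` Poly_Mapping.keys p))"

definition sos :: "'v rpoly set" where
  "sos = {p. \<exists>qs. p = (\<Sum>q\<leftarrow>qs. q ^ 2)}"


section \<open>The box, the semialgebraic set, the scaled Lebesgue measure\<close>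

text \<open>
  The dimension is the cardinality of the finite index type of the variables; a polynomial in
  \<open>x\<^sub>1, \<dots>, x\<^sub>n\<close> is evaluated at a vector \<open>x\<close> as \<open>eval p (($) x)\<close>.
\<close>

definition Delta :: "(real ^ 'n) set" where
  "Delta = {x. \<forall>i. -1 \<le> x $ i \<and> x $ i \<le> 1}"

definition Omega :: "(nat \<Rightarrow> 'n rpoly) \<Rightarrow> nat \<Rightarrow> (real ^ 'n) set" where
  "Omega g r = {x. \<forall>j\<in>{1..r}. 0 \<le> eval (g j) (($) x)}"

definition lam :: "(real ^ 'n) measure" where
  "lam = scale_measure (ennreal (1 / 2 ^ CARD('n))) (lebesgue_on Delta)"

definition certified :: "(nat \<Rightarrow> 'n::finite rpoly) \<Rightarrow> nat \<Rightarrow> 'n rpoly \<Rightarrow> bool" where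
  "certified g r f \<longleftrightarrow>
     (\<exists>s0 s t. s0 \<in> sos \<and> (\<forall>j\<in>{1..r}. s j \<in> sos) \<and> (\<forall>i. t i \<in> sos) \<and>
        f = s0 + (\<Sum>j=1..r. s j * g j) + (\<Sum>i\<in>UNIV. t i * (1 - Var i ^ 2)))"


section \<open>The value function of the parametric problem\<close>

text \<open>
  Below, \<open>D\<close> stands for the number \<open>f\<^sup>u\<^sup>p\<^sup>p\<^sup>e\<^sup>r - f\<^sup>l\<^sup>o\<^sup>w\<^sup>e\<^sup>r\<close>.
\<close>

definition psi_feasible ::
  "(nat \<Rightarrow> 'n rpoly) \<Rightarrow> (nat \<Rightarrow> 'n rpoly) \<Rightarrow> nat \<Rightarrow> (nat \<Rightarrow> 'n rpoly) \<Rightarrow> nat \<Rightarrow> real \<Rightarrow>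
   real ^ 'n \<Rightarrow> ((real ^ 'n) \<times> real) set" where
  "psi_feasible p q m g r D x =
     {(y, z). (\<forall>i\<in>{1..m}. eval (p i) (($) x) * eval (q i) (($) y)
                         - eval (p i) (($) y) * eval (q i) (($) x)
                         - z * eval (q i) (($) x) * eval (q i) (($) y) \<ge> 0) \<and>
              y \<in> Omega g r \<and> z \<in> {- D..D}}"

definition psi_tilde ::
  "(nat \<Rightarrow> 'n rpoly) \<Rightarrow> (nat \<Rightarrow> 'n rpoly) \<Rightarrow> nat \<Rightarrow> (nat \<Rightarrow> 'n rpoly) \<Rightarrow> nat \<Rightarrow> real \<Rightarrow>
   real ^ 'n \<Rightarrow> real" where
  "psi_tilde p q m g r D x = (GREATEST z. \<exists>y. (y, z) \<in> psi_feasible p q m g r D x)"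


section \<open>The hierarchy of sum-of-squares programs\<close>

text \<open>The variables of \<open>\<real>[x, y, z]\<close>.\<close>

datatype 'n xyz = XV 'n | YV 'n | ZV

abbreviation in_x :: "'n rpoly \<Rightarrow> 'n xyz rpoly" where
  "in_x \<equiv> subst (\<lambda>i. Var (XV i))"

abbreviation in_y :: "'n rpoly \<Rightarrow> 'n xyz rpoly" where
  "in_y \<equiv> subst (\<lambda>i. Var (YV i))"

text \<open>
  Index pairs \<open>(i, j)\<close> of the polynomials \<open>h\<^sub>i\<^sub>,\<^sub>j\<close>. The second family is split into
  its two halves: \<open>H2 j\<close> is the pair \<open>(2, j)\<close> with \<open>j \<le> r\<close>, and \<open>H2' j\<close> is the pair \<open>(2, r + j)\<close>.
\<close>

datatype 'n hindex = H1 nat | H2 nat | H2' 'n | H3 'n | H4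

definition hindices :: "nat \<Rightarrow> nat \<Rightarrow> 'n::finite hindex set" where
  "hindices m r = H1 ` {1..m} \<union> (H2 ` {1..r} \<union> H2' ` UNIV) \<union> H3 ` UNIV \<union> {H4}"

fun hpoly ::
  "(nat \<Rightarrow> 'n rpoly) \<Rightarrow> (nat \<Rightarrow> 'n rpoly) \<Rightarrow> (nat \<Rightarrow> 'n rpoly) \<Rightarrow> real \<Rightarrow>
   'n hindex \<Rightarrow> 'n xyz rpoly" where
  "hpoly p q g D (H1 j) = in_x (p j) * in_y (q j) - in_y (p j) * in_x (q j)
                          - Var ZV * in_x (q j) * in_y (q j)"
| "hpoly p q g D (H2 j) = in_y (g j)"
| "hpoly p q g D (H2' j) = 1 - Var (YV j) ^ 2"
| "hpoly p q g D (H3 j) = 1 - Var (XV j) ^ 2"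
| "hpoly p q g D H4 = Const (D ^ 2) - Var ZV ^ 2"

definition k_min ::
  "(nat \<Rightarrow> 'n::finite rpoly) \<Rightarrow> (nat \<Rightarrow> 'n rpoly) \<Rightarrow> nat \<Rightarrow> (nat \<Rightarrow> 'n rpoly) \<Rightarrow> nat \<Rightarrow>
   real \<Rightarrow> nat" where
  "k_min p q m g r D =
     Max ((\<lambda>c. nat \<lceil>real (deg (hpoly p q g D c)) / 2\<rceil>) ` hindices m r)"

definition sos_feasible ::
  "(nat \<Rightarrow> 'n::finite rpoly) \<Rightarrow> (nat \<Rightarrow> 'n rpoly) \<Rightarrow> nat \<Rightarrow> (nat \<Rightarrow> 'n rpoly) \<Rightarrow> nat \<Rightarrow>
   real \<Rightarrow> nat \<Rightarrow> ('n rpoly \<times> 'n xyz rpoly \<times> ('n hindex \<Rightarrow> 'n xyz rpoly)) set" where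
  "sos_feasible p q m g r D k =
     {(\<phi>, \<sigma>0, \<sigma>). deg \<phi> \<le> 2 * k \<and>
        \<sigma>0 \<in> sos \<and> (\<forall>c\<in>hindices m r. \<sigma> c \<in> sos) \<and>
        in_x \<phi> - Var ZV = \<sigma>0 + (\<Sum>c\<in>hindices m r. \<sigma> c * hpoly p q g D c) \<and>
        deg \<sigma>0 \<le> 2 * k \<and> (\<forall>c\<in>hindices m r. deg (\<sigma> c * hpoly p q g D c) \<le> 2 * k)}"

text \<open>
  The infimum is taken in the extended reals, so that neither an empty feasible set nor an
  unbounded objective produces an arbitrary real value.
\<close>

definition rho ::
  "(nat \<Rightarrow> 'n::finite rpoly) \<Rightarrow> (nat \<Rightarrow> 'n rpoly) \<Rightarrow> nat \<Rightarrow> (nat \<Rightarrow> 'n rpoly) \<Rightarrow> nat \<Rightarrow>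
   real \<Rightarrow> nat \<Rightarrow> ereal" where
  "rho p q m g r D k =
     (INF (\<phi>, \<sigma>0, \<sigma>)\<in>sos_feasible p q m g r D k. ereal (\<integral>x. eval \<phi> (($) x) \<partial>lam))"

end

(*
  A feasible pair (phi, certificate) satisfies phi >= psi on Delta (evaluate the identity at
  (x, y, psi x) with y an optimal point), so every rho_k is at least the integral of psi.
  Conversely, psi is a maximum over the sections of a compact set, hence upper semicontinuous;
  its Lipschitz sup-convolutions decrease to it pointwise, so by Stone-Weierstrass and dominated
  convergence there are polynomials phi > psi on Delta with integral arbitrarily close to that of
  psi. For such phi the polynomial phi(x) - z is positive on the compact set {h >= 0}, and Putinar's
  Positivstellensatz puts it into the quadratic module generated by the h, i.e. phi is feasible for
  all large k.

  Putinar's theorem is obtained algebraically: a maximal proper quadratic module Q over an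
  Archimedean one is total, and the cut it induces on the reals is an evaluation at a point.
  Hence a positive f admits a sum of squares s with s f - 1 in the module, and s is then eliminated.
*)

theory Submission
  imports Defs
begin

section \<open>Evaluation of polynomials\<close>

lemma poly_mapping_sum_single:
  "(\<Sum>e\<in>Poly_Mapping.keys p. Poly_Mapping.single e (Poly_Mapping.lookup p e)) = p"
  by (rule poly_mapping_eqI)
     (auto simp: lookup_sum lookup_single when_def in_keys_iff sum.delta)

lemma poly_mapping_single_add_induct [case_names single add]:
  fixes p :: "'a \<Rightarrow>\<^sub>0 'b::comm_monoid_add"
  assumes single: "\<And>e c. P (Poly_Mapping.single e c)"
    and add: "\<And>p q. P p \<Longrightarrow> P q \<Longrightarrow> P (p + q)"
  shows "P p"
proof -
  have "P (\<Sum>e\<in>A. Poly_Mapping.single e (f e))" if "finite A" for A and f :: "'a \<Rightarrow> 'b"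
    using that
  proof (induction A rule: finite_induct)
    case empty
    \<comment> \<open>\<open>Poly_Mapping.single e 0\<close> is the zero mapping for any
      \<open>e\<close>, so the empty sum is covered by the case \<open>single\<close>.\<close>
    show ?case using single[of undefined 0] by simp
  qed (simp add: add single)
  from this[of "Poly_Mapping.keys p" "Poly_Mapping.lookup p"] show ?thesis
    by (simp add: poly_mapping_sum_single)
qed

lemma Const_add: "Const (a + b) = Const a + Const b"
  by (simp add: Const_def single_add)

lemma Const_mult: "Const (a * b) = Const a * Const b"
  by (simp add: Const_def mult_single)

lemma Const_0 [simp]: "Const 0 = 0"
  by (simp add: Const_def)

lemma Const_1 [simp]: "Const 1 = 1"
  by (simp add: Const_def)

lemma Const_minus: "Const (- a) = - Const a"
  by (metis Const_0 Const_add add.right_inverse add_eq_0_iff)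

lemma Const_diff: "Const (a - b) = Const a - Const b"
  using Const_add[of a "- b"] by (simp add: Const_minus)

lemma Const_power: "Const (a ^ k) = Const a ^ k"
  by (induction k) (simp_all add: Const_mult)

lemma Const_of_nat: "Const (of_nat k) = of_nat k"
  by (induction k) (simp_all add: Const_add)

lemma Const_numeral: "Const (numeral k) = numeral k"
  using Const_of_nat[of "numeral k"] by simp

lemma single_Var_power:
  "Poly_Mapping.single (Poly_Mapping.single v k) 1 = (Var v ^ k :: 'v rpoly)"
proof (induction k)
  case (Suc k)
  have "Poly_Mapping.single (Poly_Mapping.single v (Suc k)) 1 =
      (Poly_Mapping.single (Poly_Mapping.single v 1) 1 *
       Poly_Mapping.single (Poly_Mapping.single v k) 1 :: 'v rpoly)"
    unfolding mult_single single_add[symmetric] by simp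
  with Suc show ?case by (simp add: Var_def)
qed simp

text \<open>Constants and variables generate the polynomial ring. The rule carries properties stable
  under ring operations from variables to all polynomials: having a real value in the sense of
  \<open>nearly_const\<close>, and being bounded modulo a quadratic module.\<close>

lemma rpoly_induct [case_names Const Var add mult]:
  fixes p :: "'v rpoly"
  assumes Const: "\<And>c. P (Const c)" and Var: "\<And>v. P (Var v)"
    and add: "\<And>p q. P p \<Longrightarrow> P q \<Longrightarrow> P (p + q)"
    and mult: "\<And>p q. P p \<Longrightarrow> P q \<Longrightarrow> P (p * q)"
  shows "P p"
proof (induction p rule: poly_mapping_single_add_induct)
  case (single e c)
  have mono: "P (Poly_Mapping.single e 1)"
  proof (induction e rule: poly_mapping_single_add_induct)
    case (single v k)
    have "P (Var v ^ k)"
      by (induction k) (use Const[of 1] in \<open>auto intro: Var mult\<close>)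
    then show ?case by (simp add: single_Var_power)
  next
    case (add e f)
    then show ?case
      using mult[of "Poly_Mapping.single e 1" "Poly_Mapping.single f 1"]
      by (simp add: mult_single)
  qed
  have "Poly_Mapping.single e c = Const c * Poly_Mapping.single e 1"
    by (simp add: Const_def mult_single)
  then show ?case using mult[OF Const mono] by simp
qed (rule add)

lemma eval_add: "eval (p + q) a = eval p a + eval q a"
  unfolding eval_def
  by (rule setsum_keys_plus_distrib) (auto simp: algebra_simps)

lemma eval_single:
  "eval (Poly_Mapping.single e c) a =
     c * (\<Prod>v\<in>Poly_Mapping.keys e. a v ^ Poly_Mapping.lookup e v)"
  by (simp add: eval_def)

lemma monomial_add:
  fixes e f :: "'v \<Rightarrow>\<^sub>0 nat" and a :: "'v \<Rightarrow> real"
  shows "(\<Prod>v\<in>Poly_Mapping.keys (e + f). a v ^ Poly_Mapping.lookup (e + f) v) =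
    (\<Prod>v\<in>Poly_Mapping.keys e. a v ^ Poly_Mapping.lookup e v) *
    (\<Prod>v\<in>Poly_Mapping.keys f. a v ^ Poly_Mapping.lookup f v)"
proof -
  \<comment> \<open>All supports are enlarged to one index set; the added factors are zeroth powers,
    hence 1.\<close>
  let ?S = "Poly_Mapping.keys e \<union> Poly_Mapping.keys f"
  have *: "(\<Prod>v\<in>Poly_Mapping.keys u. a v ^ Poly_Mapping.lookup u v) =
      (\<Prod>v\<in>?S. a v ^ Poly_Mapping.lookup u v)" if "Poly_Mapping.keys u \<subseteq> ?S" for u
    by (rule prod.mono_neutral_left) (use that in \<open>auto simp: in_keys_iff\<close>)
  have "(\<Prod>v\<in>Poly_Mapping.keys (e + f). a v ^ Poly_Mapping.lookup (e + f) v) =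
      (\<Prod>v\<in>?S. a v ^ Poly_Mapping.lookup (e + f) v)"
    by (rule *[OF keys_add])
  also have "\<dots> = (\<Prod>v\<in>?S. a v ^ Poly_Mapping.lookup e v) *
      (\<Prod>v\<in>?S. a v ^ Poly_Mapping.lookup f v)"
    by (simp add: lookup_add power_add prod.distrib)
  finally show ?thesis
    by (simp only: *[OF Un_upper1] *[OF Un_upper2])
qed

text \<open>Both sides are additive in \<open>p\<close> and in \<open>q\<close>, so two inductions
  reduce the claim to a product of monomials.\<close>

lemma eval_mult: "eval (p * q) a = eval p a * eval q a"
proof (induction p rule: poly_mapping_single_add_induct)
  case (single e c)
  show ?case
    by (induction q rule: poly_mapping_single_add_induct)
       (simp_all add: mult_single eval_single monomial_add eval_add distrib_left)
qed (simp add: eval_add distrib_right)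

lemma eval_Const [simp]: "eval (Const c) a = c"
  by (simp add: Const_def eval_single)

lemma eval_Var [simp]: "eval (Var v) a = a v"
  by (simp add: Var_def eval_single)

lemma eval_0 [simp]: "eval 0 a = 0"
  by (simp add: eval_def)

lemma eval_1 [simp]: "eval 1 a = 1"
  using eval_Const[of 1 a] by simp

lemma eval_minus: "eval (- p) a = - eval p a"
  using eval_add[of p "- p" a] by simp

lemma eval_diff: "eval (p - q) a = eval p a - eval q a"
  using eval_add[of p "- q" a] by (simp add: eval_minus)

lemma eval_power: "eval (p ^ k) a = eval p a ^ k"
  by (induction k) (simp_all add: eval_mult)

lemma eval_sum: "eval (\<Sum>i\<in>I. f i) a = (\<Sum>i\<in>I. eval (f i) a)"
  by (induction I rule: infinite_finite_induct) (simp_all add: eval_add)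

lemma eval_prod: "eval (\<Prod>i\<in>I. f i) a = (\<Prod>i\<in>I. eval (f i) a)"
  by (induction I rule: infinite_finite_induct) (simp_all add: eval_mult)

lemmas eval_simps = eval_add eval_mult eval_minus eval_diff eval_power eval_sum eval_prod

lemma eval_subst: "eval (subst s p) a = eval p (\<lambda>v. eval (s v) a)"
  by (simp add: subst_def eval_simps) (simp add: eval_def)

lemma eval_sos_nonneg: "p \<in> sos \<Longrightarrow> 0 \<le> eval p a"
proof -
  have "0 \<le> eval (\<Sum>q\<leftarrow>qs. q ^ 2) a" for qs :: "'a rpoly list"
    by (induction qs) (simp_all add: eval_simps)
  then show "p \<in> sos \<Longrightarrow> 0 \<le> eval p a" by (auto simp: sos_def)
qed

lemma continuous_on_eval [continuous_intros]:
  fixes a :: "'a::topological_space \<Rightarrow> 'v \<Rightarrow> real"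
  assumes "\<And>v. continuous_on S (\<lambda>x. a x v)"
  shows "continuous_on S (\<lambda>x. eval p (a x))"
  unfolding eval_def by (intro continuous_intros assms)

section \<open>The Archimedean Positivstellensatz\<close>

text \<open>Properness, \<open>- 1 \<notin> Q\<close>, is left out so that adjoining an element
  always yields a quadratic module; it appears as a separate hypothesis.\<close>

definition quadratic_module :: "'v rpoly set \<Rightarrow> bool" where
  "quadratic_module Q \<longleftrightarrow>
     1 \<in> Q \<and> (\<forall>a\<in>Q. \<forall>b\<in>Q. a + b \<in> Q) \<and> (\<forall>a. \<forall>b\<in>Q. a ^ 2 * b \<in> Q)"

definition archimedean :: "'v rpoly set \<Rightarrow> bool" where
  "archimedean Q \<longleftrightarrow> (\<forall>p. \<exists>N. Const N - p \<in> Q)"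

lemma quadratic_moduleD:
  assumes "quadratic_module Q"
  shows quadratic_module_1: "1 \<in> Q"
    and quadratic_module_add: "a \<in> Q \<Longrightarrow> b \<in> Q \<Longrightarrow> a + b \<in> Q"
    and quadratic_module_square_mult: "b \<in> Q \<Longrightarrow> a ^ 2 * b \<in> Q"
  using assms by (auto simp: quadratic_module_def)

lemma quadratic_module_square: "quadratic_module Q \<Longrightarrow> a ^ 2 \<in> Q"
  using quadratic_module_square_mult[of Q 1 a] quadratic_module_1 by auto

lemma quadratic_module_Const_mult:
  assumes "quadratic_module Q" "0 \<le> c" "b \<in> Q"
  shows "Const c * b \<in> Q"
  using quadratic_module_square_mult[OF assms(1,3), of "Const (sqrt c)"] assms(2)
  by (simp add: Const_power[symmetric])

lemma quadratic_module_Const: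
  "quadratic_module Q \<Longrightarrow> 0 \<le> c \<Longrightarrow> Const c \<in> Q"
  using quadratic_module_Const_mult[of Q c 1] quadratic_module_1 by auto

lemma sos_0: "0 \<in> sos"
  unfolding sos_def by (auto intro: exI[of _ "[]"])

lemma sos_square: "a ^ 2 \<in> sos"
  unfolding sos_def by (auto intro!: exI[of _ "[a]"])

lemma sos_1: "1 \<in> sos"
  using sos_square[of 1] by simp

lemma sos_add: "a \<in> sos \<Longrightarrow> b \<in> sos \<Longrightarrow> a + b \<in> sos"
  unfolding sos_def by clarsimp (metis map_append sum_list_append)

lemma sos_square_mult: "b \<in> sos \<Longrightarrow> a ^ 2 * b \<in> sos"
proof -
  have "a ^ 2 * (\<Sum>q\<leftarrow>qs. q ^ 2) = (\<Sum>q\<leftarrow>map ((*) a) qs. q ^ 2)" for qs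
    by (induction qs) (simp_all add: algebra_simps power_mult_distrib)
  then show "b \<in> sos \<Longrightarrow> a ^ 2 * b \<in> sos" unfolding sos_def by blast
qed

lemma quadratic_module_sos_mult:
  assumes "quadratic_module Q" "s \<in> sos" "b \<in> Q"
  shows "s * b \<in> Q"
proof -
  have "(\<Sum>q\<leftarrow>qs. q ^ 2) * b \<in> Q" for qs
    using quadratic_module_Const[OF assms(1), of 0]
    by (induction qs)
       (auto simp: distrib_right
         intro!: quadratic_module_add[OF assms(1)] quadratic_module_square_mult[OF assms(1,3)])
  with assms(2) show ?thesis by (auto simp: sos_def)
qed

text \<open>This is the smallest quadratic module containing \<open>Q\<close> and \<open>f\<close>.
  Either it is proper, or it exhibits an identity \<open>- 1 = b + s * f\<close>; that dichotomy is
  what the later arguments exploit.\<close>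

lemma quadratic_module_adjoin:
  assumes "quadratic_module Q"
  shows "quadratic_module {b + s * f | b s. b \<in> Q \<and> s \<in> sos}" (is "quadratic_module ?R")
    and "Q \<subseteq> {b + s * f | b s. b \<in> Q \<and> s \<in> sos}"
    and "f \<in> {b + s * f | b s. b \<in> Q \<and> s \<in> sos}"
proof -
  show sub: "Q \<subseteq> ?R"
    using sos_0 by force
  show "f \<in> ?R"
    using assms sos_1 quadratic_module_Const[OF assms, of 0] by force
  show "quadratic_module ?R"
    unfolding quadratic_module_def
  proof (intro conjI ballI allI)
    show "1 \<in> ?R" using sub quadratic_module_1[OF assms] by blast
  next
    fix a b assume "a \<in> ?R" "b \<in> ?R"
    then obtain a' s b' t where "a = a' + s * f" "b = b' + t * f"
      "a' \<in> Q" "b' \<in> Q" "s \<in> sos" "t \<in> sos" by auto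
    moreover have "a' + s * f + (b' + t * f) = (a' + b') + (s + t) * f"
      by (simp add: algebra_simps)
    ultimately show "a + b \<in> ?R"
      using quadratic_module_add[OF assms] sos_add by blast
  next
    fix a b assume "b \<in> ?R"
    then obtain b' s where "b = b' + s * f" "b' \<in> Q" "s \<in> sos" by auto
    moreover have "a ^ 2 * (b' + s * f) = a ^ 2 * b' + (a ^ 2 * s) * f"
      by (simp add: algebra_simps)
    ultimately show "a ^ 2 * b \<in> ?R"
      using quadratic_module_square_mult[OF assms] sos_square_mult by blast
  qed
qed

lemma Const_half_sum: "Const (1 / 2) * p + Const (1 / 2) * p = (p :: 'v rpoly)"
  by (simp add: distrib_right[symmetric] Const_add[symmetric])

text \<open>The support of a quadratic module is an ideal because every ring element is a
  difference of two squares.\<close>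

lemma quadratic_module_support_mult:
  assumes Q: "quadratic_module Q" and t: "t \<in> Q" "- t \<in> Q"
  shows "a * t \<in> Q"
proof -
  define u where "u = Const (1 / 2) * (a + 1)"
  define v where "v = Const (1 / 2) * (a - 1)"
  have "u + v = a" "u - v = 1"
    using Const_half_sum[of a] Const_half_sum[of 1] by (simp_all add: u_def v_def algebra_simps)
  then have "a * t = ((u + v) * (u - v)) * t" by simp
  also have "\<dots> = u ^ 2 * t + v ^ 2 * (- t)"
    by (simp add: algebra_simps power2_eq_square)
  finally show ?thesis
    by (simp only: quadratic_module_add[OF Q] quadratic_module_square_mult[OF Q] t)
qed

section \<open>Totality of maximal quadratic modules\<close>

text \<open>If \<open>a\<close> and \<open>- a\<close> are both missing, adjoining either one
  produces \<open>- 1\<close>. Eliminating \<open>a\<close> from the two identities shows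
  \<open>- t \<in> Q\<close> for the multiplier \<open>t\<close> of \<open>a\<close>. Hence
  \<open>t\<close> lies in the support, which is an ideal, so \<open>t * a \<in> Q\<close> and
  \<open>- 1 = s + t * a\<close> lies in \<open>Q\<close>.\<close>

lemma maximal_quadratic_module_total:
  assumes Q: "quadratic_module Q" and proper: "- 1 \<notin> Q"
    and max: "\<And>R. quadratic_module R \<Longrightarrow> - 1 \<notin> R \<Longrightarrow> Q \<subseteq> R \<Longrightarrow> R = Q"
  shows "a \<in> Q \<or> - a \<in> Q"
proof (rule ccontr)
  assume neg: "\<not> (a \<in> Q \<or> - a \<in> Q)"
  have *: "\<exists>s t. s \<in> Q \<and> t \<in> sos \<and> - 1 = s + t * f" if "f \<notin> Q" for f
    using max[OF quadratic_module_adjoin(1)[OF Q, of f] _ quadratic_module_adjoin(2)[OF Q]]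
      quadratic_module_adjoin(3)[OF Q, of f] that by blast
  obtain s t where st: "s \<in> Q" "t \<in> sos" "- 1 = s + t * a"
    using *[of a] neg by blast
  obtain s' t' where st': "s' \<in> Q" "t' \<in> sos" "- 1 = s' + t' * (- a)"
    using *[of "- a"] neg by blast
  have sos_Q: "x \<in> Q" if "x \<in> sos" for x
    using quadratic_module_sos_mult[OF Q that quadratic_module_1[OF Q]] by simp
  \<comment> \<open>The product \<open>t' * t * a\<close> is computed in two ways, once from each
    identity.\<close>
  have "- t = t' + t' * s + t * s'"
  proof -
    have "t * a = (s + t * a) - s" "t' * a = s' - (s' + t' * (- a))" by simp_all
    then have "t * a = - 1 - s" "t' * a = s' + 1"
      using st(3) st'(3) by (metis, metis diff_minus_eq_add)
    then have "t' * (- 1 - s) = t * (s' + 1)"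
      by (metis mult.left_commute)
    then have "- t' - t' * s = t * s' + t"
      by (simp add: algebra_simps)
    then have "- t = t * s' - (- t' - t' * s)" by simp
    then show ?thesis by (simp add: algebra_simps)
  qed
  then have "- t \<in> Q"
    using quadratic_module_add[OF Q] quadratic_module_sos_mult[OF Q] sos_Q st st' by auto
  then have "a * t \<in> Q"
    using quadratic_module_support_mult[OF Q sos_Q[OF st(2)]] by simp
  then have "- 1 \<in> Q"
    using st quadratic_module_add[OF Q, of s "t * a"] by (simp add: mult.commute)
  with proper show False ..
qed

section \<open>Real values of polynomials modulo infinitesimals\<close>

text \<open>\<open>Q\<close> is not assumed closed under products, so the two factors of the
  difference cannot simply be multiplied. Weighting each factor by the square of the other and
  adding gives \<open>2 * N\<close> times the difference.\<close>

lemma quadratic_module_diff_squares: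
  assumes Q: "quadratic_module Q" and "0 < N" "Const N - b \<in> Q" "Const N + b \<in> Q"
  shows "Const (N ^ 2) - b ^ 2 \<in> Q"
proof -
  let ?c = "Const N"
  have "(?c - b) ^ 2 * (?c + b) + (?c + b) ^ 2 * (?c - b) = Const 2 * ?c * (?c ^ 2 - b ^ 2)"
    by (simp add: Const_numeral algebra_simps power2_eq_square)
  then have "Const (1 / (2 * N)) * ((?c - b) ^ 2 * (?c + b) + (?c + b) ^ 2 * (?c - b)) =
      Const (1 / (2 * N) * (2 * N)) * (?c ^ 2 - b ^ 2)"
    by (simp only: Const_mult mult.assoc)
  also have "\<dots> = Const (N ^ 2) - b ^ 2"
    using \<open>0 < N\<close> by (simp add: Const_power)
  finally have eq: "Const (N ^ 2) - b ^ 2 =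
      Const (1 / (2 * N)) * ((?c - b) ^ 2 * (?c + b) + (?c + b) ^ 2 * (?c - b))" ..
  show ?thesis
    unfolding eq using quadratic_module_square_mult[OF Q] assms(2-)
    by (intro quadratic_module_Const_mult[OF Q] quadratic_module_add[OF Q]) simp_all
qed

text \<open>\<open>nearly_const Q p c\<close> says that \<open>p\<close> and \<open>c\<close> agree up to infinitesimals in the preorder
  induced by \<open>Q\<close>; for total Archimedean \<open>Q\<close> this relation is the graph of a ring
  homomorphism to the reals, that is, of the evaluation at a point.\<close>

definition nearly_const :: "'v rpoly set \<Rightarrow> 'v rpoly \<Rightarrow> real \<Rightarrow> bool" where
  "nearly_const Q p c \<longleftrightarrow>
     (\<forall>\<epsilon>>0. Const \<epsilon> + (p - Const c) \<in> Q \<and> Const \<epsilon> - (p - Const c) \<in> Q)"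

lemma nearly_const_shift: "nearly_const Q p c \<longleftrightarrow> nearly_const Q (p - Const c) 0"
  by (simp add: nearly_const_def)

lemma nearly_const_Const: "quadratic_module Q \<Longrightarrow> nearly_const Q (Const c) c"
  by (simp add: nearly_const_def quadratic_module_Const)

lemma nearly_const_add:
  assumes Q: "quadratic_module Q" and p: "nearly_const Q p c" and q: "nearly_const Q q d"
  shows "nearly_const Q (p + q) (c + d)"
  unfolding nearly_const_def
proof (intro allI impI)
  fix \<epsilon> :: real assume "\<epsilon> > 0"
  have half: "Const \<epsilon> = (Const (\<epsilon> / 2) + Const (\<epsilon> / 2) :: 'a rpoly)"
    by (simp add: Const_add[symmetric])
  have plus: "Const \<epsilon> + (p + q - Const (c + d)) =
      (Const (\<epsilon> / 2) + (p - Const c)) + (Const (\<epsilon> / 2) + (q - Const d))"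
    unfolding half by (simp add: Const_add)
  have minus: "Const \<epsilon> - (p + q - Const (c + d)) =
      (Const (\<epsilon> / 2) - (p - Const c)) + (Const (\<epsilon> / 2) - (q - Const d))"
    unfolding half by (simp add: Const_add)
  show "Const \<epsilon> + (p + q - Const (c + d)) \<in> Q \<and> Const \<epsilon> - (p + q - Const (c + d)) \<in> Q"
    unfolding plus minus
    by (intro conjI quadratic_module_add[OF Q, of "_ + _" "_ + _"]
        quadratic_module_add[OF Q, of "_ - _" "_ - _"];
      use p q \<open>\<epsilon> > 0\<close> in \<open>simp add: nearly_const_def\<close>)
qed

lemma nearly_const_scale:
  assumes Q: "quadratic_module Q" and p: "nearly_const Q p c"
  shows "nearly_const Q (Const k * p) (k * c)"
proof -
  \<comment> \<open>The tolerance is divided by \<open>\<bar>k\<bar>\<close>, so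
    \<open>k = 0\<close> is treated apart; a negative \<open>k\<close> merely swaps the two
    memberships.\<close>
  consider "k = 0" | "k \<noteq> 0" by blast
  then show ?thesis
  proof cases
    case 1
    then show ?thesis using nearly_const_Const[OF Q, of 0] by simp
  next
    case 2
    show ?thesis
      unfolding nearly_const_def
    proof (intro allI impI)
      fix \<epsilon> :: real assume "\<epsilon> > 0"
      define u where "u = p - Const c"
      have u: "Const (\<epsilon> / \<bar>k\<bar>) + u \<in> Q" "Const (\<epsilon> / \<bar>k\<bar>) - u \<in> Q"
        using p 2 \<open>\<epsilon> > 0\<close> unfolding nearly_const_def u_def by simp_all
      have ku: "Const k * p - Const (k * c) = Const k * u"
        by (simp add: u_def Const_mult algebra_simps)
      have eps: "Const \<bar>k\<bar> * Const (\<epsilon> / \<bar>k\<bar>) = (Const \<epsilon> :: 'a rpoly)"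
        using 2 by (simp add: Const_mult[symmetric])
      have "Const \<epsilon> + Const \<bar>k\<bar> * u \<in> Q" "Const \<epsilon> - Const \<bar>k\<bar> * u \<in> Q"
        using quadratic_module_Const_mult[OF Q _ u(1), of "\<bar>k\<bar>"]
          quadratic_module_Const_mult[OF Q _ u(2), of "\<bar>k\<bar>"]
        by (simp_all add: distrib_left right_diff_distrib eps)
      then show "Const \<epsilon> + (Const k * p - Const (k * c)) \<in> Q \<and>
          Const \<epsilon> - (Const k * p - Const (k * c)) \<in> Q"
        unfolding ku by (cases "k \<ge> 0") (simp_all add: Const_minus)
    qed
  qed
qed

lemma nearly_const_square_0:
  assumes Q: "quadratic_module Q" and p: "nearly_const Q p 0"
  shows "nearly_const Q (p ^ 2) 0"
  unfolding nearly_const_def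
proof (intro allI impI)
  fix \<epsilon> :: real assume "\<epsilon> > 0"
  \<comment> \<open>Closeness of \<open>p\<close> to 0 is used with tolerance
    \<open>sqrt \<epsilon>\<close>; the opposite bound is free because
    \<open>p ^ 2 \<in> Q\<close>.\<close>
  then have "Const ((sqrt \<epsilon>) ^ 2) - p ^ 2 \<in> Q"
    using p by (intro quadratic_module_diff_squares[OF Q]) (simp_all add: nearly_const_def)
  with \<open>\<epsilon> > 0\<close> show "Const \<epsilon> + (p ^ 2 - Const 0) \<in> Q \<and> Const \<epsilon> - (p ^ 2 - Const 0) \<in> Q"
    using quadratic_module_add[OF Q quadratic_module_Const[OF Q] quadratic_module_square[OF Q]]
    by simp
qed

text \<open>Products become combinations of squares, so bounds for squares suffice both for
  \<open>nearly_const_mult\<close> and for \<open>archimedeanI\<close>.\<close>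

lemma mult_polarization:
  "p * q = Const (1 / 4) * (p + q) ^ 2 + Const (- (1 / 4)) * (p - q) ^ 2"
proof -
  have "Const (1 / 4) * (p + q) ^ 2 + Const (- (1 / 4)) * (p - q) ^ 2 =
      Const (1 / 4) * (Const 4 * (p * q))"
    by (simp add: Const_minus Const_numeral algebra_simps power2_eq_square)
  also have "\<dots> = p * q"
    by (simp add: mult.assoc[symmetric] Const_mult[symmetric])
  finally show ?thesis ..
qed

text \<open>With \<open>u\<close> and \<open>v\<close> the deviations from \<open>c\<close> and
  \<open>d\<close>, the product is \<open>u * v + d * u + c * v + c * d\<close>; polarization makes
  \<open>u * v\<close> infinitesimal, and the other terms follow by linearity.\<close>

lemma nearly_const_mult:
  assumes Q: "quadratic_module Q" and p: "nearly_const Q p c" and q: "nearly_const Q q d"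
  shows "nearly_const Q (p * q) (c * d)"
proof -
  define u where "u = p - Const c"
  define v where "v = q - Const d"
  have u: "nearly_const Q u 0" and v: "nearly_const Q v 0"
    using p q nearly_const_shift unfolding u_def v_def by blast+
  note add = nearly_const_add[OF Q] and scale = nearly_const_scale[OF Q]
  have "nearly_const Q (u - v) 0"
    using add[OF u scale[OF v, of "- 1"]] by (simp add: Const_minus)
  moreover have "nearly_const Q (u + v) 0"
    using add[OF u v] by simp
  ultimately have "nearly_const Q (u * v) 0"
    using add[OF scale[OF nearly_const_square_0[OF Q], of "u + v" "1 / 4"]
        scale[OF nearly_const_square_0[OF Q], of "u - v" "- (1 / 4)"]]
      mult_polarization[of u v] by simp
  from add[OF this add[OF add[OF scale[OF u, of d] scale[OF v, of c]]
        nearly_const_Const[OF Q, of "c * d"]]]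
  have "nearly_const Q (u * v + (Const d * u + Const c * v + Const (c * d))) (c * d)"
    by simp
  also have "u * v + (Const d * u + Const c * v + Const (c * d)) = p * q"
    by (simp add: u_def v_def Const_mult algebra_simps)
  finally show ?thesis .
qed

text \<open>A negative constant could be scaled by a positive factor to \<open>- 1\<close>.\<close>

lemma quadratic_module_Const_neg:
  assumes Q: "quadratic_module Q" "- 1 \<notin> Q" and c: "Const c \<in> Q"
  shows "0 \<le> c"
proof (rule ccontr)
  assume "\<not> 0 \<le> c"
  then have "Const (1 / - c) * Const c \<in> Q"
    using c by (intro quadratic_module_Const_mult[OF Q(1)]) auto
  moreover have "Const (1 / - c) * Const c = (- 1 :: 'a rpoly)"
    using \<open>\<not> 0 \<le> c\<close> Const_minus[of 1] by (simp flip: Const_mult)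
  ultimately show False using Q(2) by simp
qed

text \<open>The value is the Dedekind cut of the reals \<open>c\<close> that \<open>Q\<close>
  certifies as lower bounds of \<open>p\<close>. The Archimedean property makes this set nonempty
  and bounded above, and totality certifies the upper half of the cut.\<close>

lemma nearly_const_exists:
  assumes Q: "quadratic_module Q" "- 1 \<notin> Q" and total: "\<And>a. a \<in> Q \<or> - a \<in> Q"
    and arch: "archimedean Q"
  shows "\<exists>c. nearly_const Q p c"
proof
  define S where "S = {c. p - Const c \<in> Q}"
  obtain N where N: "Const N - p \<in> Q" using arch by (auto simp: archimedean_def)
  obtain N' where N': "Const N' + p \<in> Q"
    using arch[unfolded archimedean_def, rule_format, of "- p"] by auto
  have "- N' \<in> S" using N' by (simp add: S_def Const_minus add.commute)
  have bound: "c \<le> N" if "c \<in> S" for c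
    using quadratic_module_Const_neg[OF Q, of "N - c"] quadratic_module_add[OF Q(1) N, of "p - Const c"]
      that by (simp add: S_def Const_diff)
  then have bdd: "bdd_above S" by (rule bdd_aboveI)
  show "nearly_const Q p (Sup S)"
    unfolding nearly_const_def
  proof (intro allI impI conjI)
    fix \<epsilon> :: real assume "\<epsilon> > 0"
    have "Sup S - \<epsilon> < Sup S" using \<open>\<epsilon> > 0\<close> by simp
    then obtain c where c: "c \<in> S" "Sup S - \<epsilon> < c"
      using less_cSup_iff[OF _ bdd] \<open>- N' \<in> S\<close> by blast
    have "Const \<epsilon> + (p - Const (Sup S)) = Const (c - (Sup S - \<epsilon>)) + (p - Const c)"
      by (simp add: Const_diff)
    also have "\<dots> \<in> Q"
      using c by (intro quadratic_module_add[OF Q(1)] quadratic_module_Const[OF Q(1)]) (simp_all add: S_def)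
    finally show "Const \<epsilon> + (p - Const (Sup S)) \<in> Q" .
    \<comment> \<open>Above the supremum the lower bound fails, so by totality its negation belongs
      to \<open>Q\<close>.\<close>
    have "Sup S + \<epsilon> \<notin> S"
      using cSup_upper[OF _ bdd, of "Sup S + \<epsilon>"] \<open>\<epsilon> > 0\<close> by auto
    then have "- (p - Const (Sup S + \<epsilon>)) \<in> Q"
      using total[of "p - Const (Sup S + \<epsilon>)"] unfolding S_def by blast
    then show "Const \<epsilon> - (p - Const (Sup S)) \<in> Q" by (simp add: Const_add algebra_simps)
  qed
qed

text \<open>The coordinates of the point are the real values of the variables. Compatibility with
  sums and products then identifies the value of every \<open>p\<close> with
  \<open>eval p a\<close>.\<close>

lemma total_quadratic_module_point:
  fixes Q :: "'v rpoly set"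
  assumes Q: "quadratic_module Q" "- 1 \<notin> Q" and total: "\<And>a. a \<in> Q \<or> - a \<in> Q"
    and arch: "archimedean Q"
  shows "\<exists>a. \<forall>p\<in>Q. 0 \<le> eval p a"
proof -
  have "\<forall>v. \<exists>c. nearly_const Q (Var v) c"
    using nearly_const_exists[OF assms] by blast
  then obtain a where a: "\<And>v. nearly_const Q (Var v) (a v)"
    by metis
  have near: "nearly_const Q p (eval p a)" for p
    by (induction p rule: rpoly_induct)
       (simp_all add: a eval_simps nearly_const_Const nearly_const_add nearly_const_mult Q)
  have "0 \<le> eval p a" if "p \<in> Q" for p
  proof (rule ccontr)
    assume neg: "\<not> 0 \<le> eval p a"
    \<comment> \<open>The tolerance is half of the absolute value of \<open>eval p a\<close>; adding
      \<open>p\<close> leaves the negative constant \<open>eval p a / 2\<close> in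
      \<open>Q\<close>.\<close>
    then have "Const (- (eval p a) / 2) - (p - Const (eval p a)) \<in> Q"
      using near[of p] by (simp add: nearly_const_def)
    from quadratic_module_add[OF Q(1) this that]
    have "Const (- (eval p a) / 2) + Const (eval p a) \<in> Q" by simp
    then have "0 \<le> - (eval p a) / 2 + eval p a"
      by (intro quadratic_module_Const_neg[OF Q]) (simp only: Const_add)
    with neg show False by simp
  qed
  then show ?thesis by blast
qed

section \<open>Positivity certificates\<close>

text \<open>Zorn's lemma applies because two elements of the union of a chain already lie in a
  common member, and \<open>- 1\<close> lies in no member.\<close>

lemma quadratic_module_maximal_extension:
  fixes R :: "'v rpoly set"
  assumes "quadratic_module R" "- 1 \<notin> R"
  obtains Q where "quadratic_module Q" "- 1 \<notin> Q" "R \<subseteq> Q" "\<And>a. a \<in> Q \<or> - a \<in> Q"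
proof -
  define \<A> where "\<A> = {Q. quadratic_module Q \<and> - 1 \<notin> Q \<and> R \<subseteq> Q}"
  have "\<exists>Q\<in>\<A>. \<forall>X\<in>\<A>. Q \<subseteq> X \<longrightarrow> X = Q"
  proof (rule subset_Zorn_nonempty)
    show "\<A> \<noteq> {}" using assms by (auto simp: \<A>_def)
    fix C assume C: "C \<noteq> {}" "subset.chain \<A> C"
    have "quadratic_module X" "- 1 \<notin> X" "R \<subseteq> X" if "X \<in> C" for X
      using C that by (auto simp: subset.chain_def \<A>_def)
    note C1 = this
    have lin: "X \<subseteq> Y \<or> Y \<subseteq> X" if "X \<in> C" "Y \<in> C" for X Y
      using C that by (auto simp: subset.chain_def)
    have "quadratic_module (\<Union>C)"
      unfolding quadratic_module_def
    proof (intro conjI ballI allI)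
      show "1 \<in> \<Union>C" using C(1) quadratic_module_1[OF C1(1)] by blast
      show "a + b \<in> \<Union>C" if ab: "a \<in> \<Union>C" "b \<in> \<Union>C" for a b
      proof -
        obtain X where "X \<in> C" "a \<in> X" "b \<in> X" using ab lin by blast
        then show ?thesis using quadratic_module_add[OF C1(1)] by blast
      qed
      show "a ^ 2 * b \<in> \<Union>C" if "b \<in> \<Union>C" for a b
        using that quadratic_module_square_mult[OF C1(1)] by blast
    qed
    then show "\<Union>C \<in> \<A>" using C(1) C1 unfolding \<A>_def by blast
  qed
  then obtain Q where Q: "Q \<in> \<A>" "\<And>X. X \<in> \<A> \<Longrightarrow> Q \<subseteq> X \<Longrightarrow> X = Q" by blast
  have "a \<in> Q \<or> - a \<in> Q" for a
    using Q by (intro maximal_quadratic_module_total) (auto simp: \<A>_def)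
  with Q(1) that show ?thesis by (auto simp: \<A>_def)
qed

text \<open>Without such an \<open>s\<close>, adjoining \<open>- f\<close> to \<open>M\<close> stays
  proper. A total extension inherits the Archimedean property from \<open>M\<close>, and its point
  satisfies all of \<open>M\<close> yet gives \<open>f\<close> a value at most 0.\<close>

lemma positive_certificate_with_multiplier:
  assumes M: "quadratic_module M" "archimedean M"
    and pos: "\<And>a. (\<forall>h\<in>M. 0 \<le> eval h a) \<Longrightarrow> 0 < eval f a"
  shows "\<exists>s\<in>sos. s * f - 1 \<in> M"
proof (rule ccontr)
  assume no: "\<not> (\<exists>s\<in>sos. s * f - 1 \<in> M)"
  define R where "R = {b + s * (- f) | b s. b \<in> M \<and> s \<in> sos}"
  have "- 1 \<notin> R"
  proof
    assume "- 1 \<in> R"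
    then obtain b s where bs: "- 1 = b + s * (- f)" "b \<in> M" "s \<in> sos" by (auto simp: R_def)
    then have "s * f - 1 = b" by (simp add: algebra_simps)
    with no bs show False by blast
  qed
  moreover have "quadratic_module R" "M \<subseteq> R" "- f \<in> R"
    unfolding R_def by (rule quadratic_module_adjoin[OF M(1)])+
  ultimately obtain Q where Q: "quadratic_module Q" "- 1 \<notin> Q" "R \<subseteq> Q" "\<And>a. a \<in> Q \<or> - a \<in> Q"
    using quadratic_module_maximal_extension by metis
  have "archimedean Q"
    using M(2) Q(3) \<open>M \<subseteq> R\<close> unfolding archimedean_def by blast
  from total_quadratic_module_point[OF Q(1,2,4) this]
  obtain a where a: "\<forall>p\<in>Q. 0 \<le> eval p a" by blast
  have "0 \<le> eval (- f) a" using a Q(3) \<open>- f \<in> R\<close> by blast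
  moreover have "0 < eval f a" using a Q(3) \<open>M \<subseteq> R\<close> by (intro pos) blast
  ultimately show False by (simp add: eval_simps)
qed

text \<open>The multiplier \<open>s\<close> is removed by lowering \<open>c\<close> in \<open>f + c \<in> M\<close> by the fixed amount
  \<open>1 / k\<^sup>2\<close> as often as necessary (Woermann's trick).\<close>

lemma multiplier_elimination_step:
  assumes M: "quadratic_module M" and s: "s \<in> sos" "s * f - 1 \<in> M"
    and k: "0 < k" "Const (2 * k) - s \<in> M" "Const (2 * k) - (s ^ 2 * f + 1) \<in> M"
    and c: "0 \<le> c" "f + Const c \<in> M"
  shows "f + Const (c - 1 / k ^ 2) \<in> M"
proof -
  let ?k = "Const k" and ?c = "Const c"
  have k2: "Const (2 * k) = ?k + ?k"
    by (simp add: Const_add[symmetric])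
  have "Const (k ^ 2) * (f + Const (c - 1 / k ^ 2)) = ?k ^ 2 * f + ?k ^ 2 * ?c - 1"
    using k(1) by (simp add: Const_diff Const_power[symmetric] right_diff_distrib distrib_left
        Const_mult[symmetric])
  \<comment> \<open>After expanding the square, the second summand cancels the term
    \<open>- 2 * k * s * f\<close>, the third cancels \<open>s ^ 2 * f\<close>, and the last cancels
    the terms in which \<open>s\<close> meets \<open>c\<close>.\<close>
  also have "\<dots> = (?k - s) ^ 2 * (f + ?c) + Const (2 * k) * (s * f - 1) +
      (Const (2 * k) - (s ^ 2 * f + 1)) + ?c * (s * (Const (2 * k) - s))"
    unfolding k2 by (simp add: algebra_simps power2_eq_square)
  also have "\<dots> \<in> M"
  proof (intro quadratic_module_add[OF M])
    show "(?k - s) ^ 2 * (f + ?c) \<in> M"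
      by (rule quadratic_module_square_mult[OF M c(2)])
    show "Const (2 * k) * (s * f - 1) \<in> M"
      using k(1) s(2) by (intro quadratic_module_Const_mult[OF M]) simp_all
    show "?c * (s * (Const (2 * k) - s)) \<in> M"
      by (intro quadratic_module_Const_mult[OF M] quadratic_module_sos_mult[OF M] c(1) s(1) k(2))
  qed (rule k(3))
  finally have "Const (1 / k ^ 2) * (Const (k ^ 2) * (f + Const (c - 1 / k ^ 2))) \<in> M"
    by (rule quadratic_module_Const_mult[OF M, rotated]) (use k(1) in simp)
  moreover have "Const (1 / k ^ 2) * (Const (k ^ 2) * u) = u" for u :: "'a rpoly"
    using k(1) by (simp add: mult.assoc[symmetric] Const_mult[symmetric])
  ultimately show ?thesis by metis
qed

text \<open>The Archimedean property supplies some \<open>f + Const c \<in> M\<close>. The descent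
  step has a fixed length, since \<open>k\<close> depends only on \<open>s\<close> and
  \<open>f\<close>, so finitely many steps bring \<open>c\<close> to 0.\<close>

theorem archimedean_positivstellensatz:
  assumes M: "quadratic_module M" "archimedean M"
    and pos: "\<And>a. (\<forall>h\<in>M. 0 \<le> eval h a) \<Longrightarrow> 0 < eval f a"
  shows "f \<in> M"
proof -
  obtain s where s: "s \<in> sos" "s * f - 1 \<in> M"
    using positive_certificate_with_multiplier[OF assms] by blast
  obtain N1 N2 N3 where N: "Const N1 - s \<in> M" "Const N2 - (s ^ 2 * f + 1) \<in> M"
    "Const N3 - (- f) \<in> M"
    using M(2) unfolding archimedean_def by blast
  have mono: "Const N' - h \<in> M" if "Const N - h \<in> M" "N \<le> N'" for N N' h
    using quadratic_module_add[OF M(1) that(1) quadratic_module_Const[OF M(1)], of "N' - N"] that(2)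
    by (simp add: Const_diff)
  \<comment> \<open>One positive \<open>k\<close> with \<open>2 * k\<close> above both
    bounds.\<close>
  define k where "k = \<bar>N1\<bar> + \<bar>N2\<bar> + 1"
  have k: "0 < k" "Const (2 * k) - s \<in> M" "Const (2 * k) - (s ^ 2 * f + 1) \<in> M"
    using mono[OF N(1), of "2 * k"] mono[OF N(2), of "2 * k"] by (auto simp: k_def)
  \<comment> \<open>Here \<open>n\<close> counts the steps still available; for \<open>n = 0\<close>
    the bounds force \<open>c = 0\<close>.\<close>
  have descent: "f \<in> M" if "0 \<le> c" "c \<le> real n / k ^ 2" "f + Const c \<in> M" for c n
    using that
  proof (induction n arbitrary: c)
    case (Suc n)
    let ?d = "c - 1 / k ^ 2"
    have step: "f + Const ?d \<in> M"
      by (rule multiplier_elimination_step[OF M(1) s k Suc.prems(1,3)])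
    show ?case
    proof (cases "0 \<le> ?d")
      case True
      then show ?thesis
        using Suc.prems(2) step by (intro Suc.IH[of ?d]) (simp_all add: add_divide_distrib)
    next
      \<comment> \<open>The last step may overshoot below 0; adding back the nonnegative constant
        \<open>- ?d\<close> lands exactly on \<open>f\<close>.\<close>
      case False
      then show ?thesis
        using quadratic_module_add[OF M(1) step quadratic_module_Const[OF M(1)], of "- ?d"]
        by (simp only: Const_minus) simp
    qed
  qed simp
  obtain n :: nat where "\<bar>N3\<bar> * k ^ 2 \<le> n" using real_arch_simple by blast
  then show ?thesis
    using descent[of "\<bar>N3\<bar>" n] mono[OF N(3), of "\<bar>N3\<bar>"] k(1)
    by (simp add: pos_le_divide_eq add.commute)
qed

section \<open>A criterion for the Archimedean property\<close>

text \<open>The polynomials bounded on both sides modulo \<open>Q\<close> form a subring containing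
  the constants. A bound on the square of a variable bounds the variable, so this subring is
  everything.\<close>

lemma archimedeanI:
  assumes Q: "quadratic_module Q" and sq: "\<And>v. \<exists>N. Const N - Var v ^ 2 \<in> Q"
  shows "archimedean Q"
proof -
  have "\<exists>N>0. Const N - p \<in> Q \<and> Const N + p \<in> Q" for p
  proof (induction p rule: rpoly_induct)
    case (Const c)
    show ?case
      by (intro exI[of _ "\<bar>c\<bar> + 1"])
         (auto simp flip: Const_add Const_diff intro!: quadratic_module_Const[OF Q])
  next
    case (Var v)
    obtain N where N: "Const N - Var v ^ 2 \<in> Q" using sq by blast
    let ?x = "Var v" and ?N = "\<bar>N\<bar>"
    have *: "Const ?N - Var v ^ 2 \<in> Q"
      using quadratic_module_add[OF Q N quadratic_module_Const[OF Q], of "?N - N"]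
      by (simp add: Const_diff)
    have half: "Const ((?N + 1) / 2) = Const (1 / 2) * (Const ?N + 1)"
      by (simp flip: Const_mult Const_add Const_1)
    \<comment> \<open>Adding the bound on the square to \<open>(?x + 1) ^ 2\<close> or
      \<open>(?x - 1) ^ 2\<close> leaves a linear expression.\<close>
    have double: "(?x + 1) ^ 2 + (Const ?N - ?x ^ 2) = (Const ?N + 1) + (?x + ?x)"
      "(?x - 1) ^ 2 + (Const ?N - ?x ^ 2) = (Const ?N + 1) + (- ?x + - ?x)"
      by (simp_all add: algebra_simps power2_eq_square)
    have eq: "Const ((?N + 1) / 2) + ?x = Const (1 / 2) * ((?x + 1) ^ 2 + (Const ?N - ?x ^ 2))"
      "Const ((?N + 1) / 2) - ?x = Const (1 / 2) * ((?x - 1) ^ 2 + (Const ?N - ?x ^ 2))"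
      unfolding double half distrib_left[of "Const (1 / 2)" "Const ?N + 1"]
        distrib_left[of "Const (1 / 2)" "?x" "?x"] distrib_left[of "Const (1 / 2)" "- ?x" "- ?x"] Const_half_sum
      by simp_all
    have "Const ((?N + 1) / 2) + ?x \<in> Q" "Const ((?N + 1) / 2) - ?x \<in> Q"
      unfolding eq
      by (intro quadratic_module_Const_mult[OF Q] quadratic_module_add[OF Q] *
          quadratic_module_square[OF Q]; simp)+
    then show ?case by (intro exI[of _ "(?N + 1) / 2"]) auto
  next
    case (add p q)
    then obtain N N' where N: "0 < N" "Const N - p \<in> Q" "Const N + p \<in> Q"
      "0 < N'" "Const N' - q \<in> Q" "Const N' + q \<in> Q" by blast
    show ?case
      using quadratic_module_add[OF Q N(2,5)] quadratic_module_add[OF Q N(3,6)] N(1,4)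
      by (intro exI[of _ "N + N'"]) (simp add: Const_add algebra_simps)
  next
    case (mult p q)
    then obtain N N' where N: "0 < N" "Const N - p \<in> Q" "Const N + p \<in> Q"
      "0 < N'" "Const N' - q \<in> Q" "Const N' + q \<in> Q" by blast
    define L where "L = N + N'"
    have L: "0 < L" "Const L - (p + q) \<in> Q" "Const L + (p + q) \<in> Q"
        "Const L - (p - q) \<in> Q" "Const L + (p - q) \<in> Q"
      using quadratic_module_add[OF Q N(2,5)] quadratic_module_add[OF Q N(3,6)]
        quadratic_module_add[OF Q N(2,6)] quadratic_module_add[OF Q N(3,5)] N(1,4)
      by (simp_all add: L_def Const_add algebra_simps)
    have sq_bound: "Const (L ^ 2) - (p + q) ^ 2 \<in> Q" "Const (L ^ 2) - (p - q) ^ 2 \<in> Q"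
      by (intro quadratic_module_diff_squares[OF Q] L)+
    have scaled: "Const (1 / 4) * (Const (L ^ 2) - u) = Const (L ^ 2 / 4) - Const (1 / 4) * u" for u
      by (simp add: right_diff_distrib flip: Const_mult)
    have eq: "Const (L ^ 2 / 4) - p * q =
        Const (1 / 4) * (Const (L ^ 2) - (p + q) ^ 2) + Const (1 / 4) * (p - q) ^ 2"
      "Const (L ^ 2 / 4) + p * q =
        Const (1 / 4) * (Const (L ^ 2) - (p - q) ^ 2) + Const (1 / 4) * (p + q) ^ 2"
      unfolding scaled mult_polarization[of p q] by (simp_all add: Const_minus)
    have "Const (L ^ 2 / 4) - p * q \<in> Q" "Const (L ^ 2 / 4) + p * q \<in> Q"
      unfolding eq
      by (intro quadratic_module_add[OF Q] quadratic_module_Const_mult[OF Q] sq_bound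
          quadratic_module_square[OF Q]; simp)+
    then show ?case using L(1) by (intro exI[of _ "L ^ 2 / 4"]) auto
  qed
  then show ?thesis unfolding archimedean_def by blast
qed

section \<open>Modules generated by a family\<close>

text \<open>This is the shape of the identity in \<open>sos_feasible\<close>, freed of the degree
  bounds.\<close>

definition generated_module :: "'c set \<Rightarrow> ('c \<Rightarrow> 'v rpoly) \<Rightarrow> 'v rpoly set" where
  "generated_module C h =
     {s0 + (\<Sum>c\<in>C. s c * h c) | s0 s. s0 \<in> sos \<and> (\<forall>c\<in>C. s c \<in> sos)}"

lemma generated_moduleI:
  "s0 \<in> sos \<Longrightarrow> (\<And>c. c \<in> C \<Longrightarrow> s c \<in> sos) \<Longrightarrow>
     s0 + (\<Sum>c\<in>C. s c * h c) \<in> generated_module C h"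
  unfolding generated_module_def by blast

lemma generated_moduleE:
  assumes "f \<in> generated_module C h"
  obtains s0 s where "f = s0 + (\<Sum>c\<in>C. s c * h c)" "s0 \<in> sos" "\<And>c. c \<in> C \<Longrightarrow> s c \<in> sos"
  using assms unfolding generated_module_def by blast

lemma quadratic_module_generated: "quadratic_module (generated_module C h)"
  unfolding quadratic_module_def
proof (intro conjI ballI allI)
  show "1 \<in> generated_module C h"
    using generated_moduleI[OF sos_1, of C "\<lambda>_. 0" h] sos_0 by simp
next
  fix a b assume "a \<in> generated_module C h" "b \<in> generated_module C h"
  then obtain s0 s t0 t where st: "a = s0 + (\<Sum>c\<in>C. s c * h c)" "b = t0 + (\<Sum>c\<in>C. t c * h c)"
    "s0 \<in> sos" "t0 \<in> sos" "\<And>c. c \<in> C \<Longrightarrow> s c \<in> sos" "\<And>c. c \<in> C \<Longrightarrow> t c \<in> sos"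
    by (elim generated_moduleE) blast
  have "a + b = (s0 + t0) + (\<Sum>c\<in>C. (s c + t c) * h c)"
    unfolding st by (simp add: distrib_right sum.distrib)
  also have "\<dots> \<in> generated_module C h"
    using st by (intro generated_moduleI sos_add)
  finally show "a + b \<in> generated_module C h" .
next
  fix a b assume "b \<in> generated_module C h"
  then obtain t0 t where t: "b = t0 + (\<Sum>c\<in>C. t c * h c)" "t0 \<in> sos" "\<And>c. c \<in> C \<Longrightarrow> t c \<in> sos"
    by (elim generated_moduleE) blast
  have "a ^ 2 * b = a ^ 2 * t0 + (\<Sum>c\<in>C. (a ^ 2 * t c) * h c)"
    unfolding t(1) by (simp add: distrib_left sum_distrib_left mult.assoc)
  also have "\<dots> \<in> generated_module C h"
    using t by (intro generated_moduleI sos_square_mult)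
  finally show "a ^ 2 * b \<in> generated_module C h" .
qed

lemma generator_in_generated_module:
  assumes "finite C" "c \<in> C"
  shows "h c \<in> generated_module C h"
proof -
  have "0 + (\<Sum>d\<in>C. (if d = c then 1 else 0) * h d) = h c"
    using assms by (simp add: if_distrib[of "\<lambda>u. u * _"] sum.delta cong: if_cong)
  moreover have "0 + (\<Sum>d\<in>C. (if d = c then 1 else 0) * h d) \<in> generated_module C h"
    by (rule generated_moduleI[OF sos_0]) (simp add: sos_0 sos_1)
  ultimately show ?thesis by metis
qed

section \<open>Maxima over the sections of a compact set\<close>

text \<open>\<open>f x\<close> is the maximum of the section of \<open>E\<close> over
  \<open>x\<close>. Compactness of \<open>E\<close> encodes the upper semicontinuity and boundedness
  of \<open>f\<close>.\<close>

locale compact_section_max =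
  fixes X :: "'a::euclidean_space set" and E :: "('a \<times> real) set" and f :: "'a \<Rightarrow> real"
  assumes compact_E: "compact E"
    and f_mem: "\<And>x. x \<in> X \<Longrightarrow> (x, f x) \<in> E"
    and E_below: "\<And>x z. (x, z) \<in> E \<Longrightarrow> x \<in> X \<and> z \<le> f x"
begin

text \<open>The set is the projection of a compact part of \<open>E\<close>. This is upper
  semicontinuity, and later gives measurability.\<close>

lemma closed_superlevel: "closed {x \<in> X. c \<le> f x}"
proof -
  have "{x \<in> X. c \<le> f x} = fst ` (E \<inter> {w. c \<le> snd w})"
  proof (intro equalityI subsetI)
    fix x assume "x \<in> {x \<in> X. c \<le> f x}"
    then show "x \<in> fst ` (E \<inter> {w. c \<le> snd w})"
      using f_mem[of x] by (intro image_eqI[of _ _ "(x, f x)"]) auto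
  qed (use E_below in force)
  moreover have "compact (fst ` (E \<inter> {w. c \<le> snd w}))"
    by (intro compact_continuous_image compact_Int_closed compact_E closed_Collect_le
        continuous_intros)
  ultimately show ?thesis by (simp add: compact_imp_closed)
qed

text \<open>The Lipschitz sup-convolution of \<open>f\<close>. Ranging over \<open>E\<close> instead
  of the graph of \<open>f\<close> does not change the supremum, since lower points of a section
  contribute less, and it makes the index set compact.\<close>

definition sup_conv :: "nat \<Rightarrow> 'a \<Rightarrow> real" where
  "sup_conv n x = Sup ((\<lambda>w. snd w - real n * dist x (fst w)) ` E)"

lemma compact_sup_conv_image: "compact ((\<lambda>w. snd w - real n * dist x (fst w)) ` E)"
  by (intro compact_continuous_image compact_E continuous_intros)

lemma sup_conv_upper: "w \<in> E \<Longrightarrow> snd w - real n * dist x (fst w) \<le> sup_conv n x"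
  unfolding sup_conv_def
  by (intro cSup_upper imageI bounded_imp_bdd_above compact_imp_bounded compact_sup_conv_image)

lemma sup_conv_least:
  assumes "E \<noteq> {}" "\<And>w. w \<in> E \<Longrightarrow> snd w - real n * dist x (fst w) \<le> c"
  shows "sup_conv n x \<le> c"
  unfolding sup_conv_def using assms by (intro cSup_least) auto

lemma sup_conv_ge: "x \<in> X \<Longrightarrow> f x \<le> sup_conv n x"
  using sup_conv_upper[OF f_mem, of x n x] by simp

lemma continuous_on_sup_conv:
  assumes "E \<noteq> {}"
  shows "continuous_on S (sup_conv n)"
proof (rule lipschitz_on_continuous_on)
  have le: "sup_conv n x \<le> sup_conv n x' + real n * dist x x'" for x x'
  proof (rule sup_conv_least[OF assms])
    fix w assume "w \<in> E"
    have "real n * dist x' (fst w) \<le> real n * (dist x (fst w) + dist x x')"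
      by (intro mult_left_mono) (metis dist_commute dist_triangle add.commute, simp)
    then show "snd w - real n * dist x (fst w) \<le> sup_conv n x' + real n * dist x x'"
      using sup_conv_upper[OF \<open>w \<in> E\<close>, of n x'] by (simp add: distrib_left)
  qed
  show "(real n)-lipschitz_on S (sup_conv n)"
  proof (rule lipschitz_onI)
    fix x x'
    show "dist (sup_conv n x) (sup_conv n x') \<le> real n * dist x x'"
      using le[of x x'] le[of x' x] by (simp add: dist_real_def dist_commute[of x' x] abs_le_iff)
  qed simp
qed

text \<open>Points of \<open>E\<close> higher than \<open>f x + e / 2\<close> project to a compact
  set missing \<open>x\<close>, hence stay at a distance \<open>d\<close> from it; for large
  \<open>n\<close> the penalty outweighs their height.\<close>

lemma sup_conv_tendsto:
  assumes x: "x \<in> X"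
  shows "(\<lambda>n. sup_conv n x) \<longlonglongrightarrow> f x"
proof (rule LIMSEQ_I)
  fix e :: real assume "0 < e"
  have ne: "E \<noteq> {}" using f_mem[OF x] by blast
  obtain B where B: "\<And>w. w \<in> E \<Longrightarrow> snd w \<le> B"
    using compact_attains_sup[OF compact_continuous_image[OF continuous_on_snd[OF continuous_on_id] compact_E]] ne
    by auto
  define E' where "E' = E \<inter> {w. f x + e / 2 \<le> snd w}"
  have "compact (fst ` E')" unfolding E'_def
    by (intro compact_continuous_image compact_Int_closed compact_E closed_Collect_le
        continuous_intros)
  moreover have "x \<notin> fst ` E'"
    using E_below \<open>0 < e\<close> by (force simp: E'_def)
  ultimately obtain d where d: "0 < d" "\<And>u. u \<in> fst ` E' \<Longrightarrow> d \<le> dist x u"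
    using separate_point_closed[OF compact_imp_closed, of "fst ` E'" x] by metis
  \<comment> \<open>From \<open>N\<close> on, the penalty at distance \<open>d\<close> exceeds the
    largest possible gain \<open>B - f x\<close>.\<close>
  obtain N :: nat where N: "(B - f x) / d \<le> real N" using real_arch_simple by blast
  have "norm (sup_conv n x - f x) < e" if "N \<le> n" for n
  proof -
    have "sup_conv n x \<le> f x + e / 2"
    proof (rule sup_conv_least[OF ne])
      fix w assume w: "w \<in> E"
      show "snd w - real n * dist x (fst w) \<le> f x + e / 2"
      proof (cases "w \<in> E'")
        case True
        then have "real N * d \<le> real n * dist x (fst w)"
          using d that by (intro mult_mono) auto
        moreover have "B - f x \<le> real N * d"
          using N d(1) by (simp add: pos_divide_le_eq)
        ultimately show ?thesis using B[OF w] \<open>0 < e\<close> by simp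
      next
        case False
        then have "snd w \<le> f x + e / 2" using w by (auto simp: E'_def)
        moreover have "0 \<le> real n * dist x (fst w)" by simp
        ultimately show ?thesis by linarith
      qed
    qed
    then show ?thesis using sup_conv_ge[OF x, of n] \<open>0 < e\<close> by simp
  qed
  then show "\<exists>no. \<forall>n\<ge>no. norm (sup_conv n x - f x) < e" by blast
qed

text \<open>The bound is independent of \<open>n\<close>, so it serves as the dominating function
  for the limit of the integrals.\<close>

lemma sup_conv_bounded:
  assumes "X \<noteq> {}"
  obtains B where "\<And>x. x \<in> X \<Longrightarrow> \<bar>f x\<bar> \<le> B" "\<And>x n. x \<in> X \<Longrightarrow> \<bar>sup_conv n x\<bar> \<le> B"
proof -
  have ne: "E \<noteq> {}" using f_mem assms by blast
  have "bounded (snd ` E)"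
    by (intro compact_imp_bounded compact_continuous_image compact_E continuous_intros)
  then obtain B where B: "\<And>w. w \<in> E \<Longrightarrow> \<bar>snd w\<bar> \<le> B"
    unfolding bounded_iff by auto
  have f: "\<bar>f x\<bar> \<le> B" if "x \<in> X" for x using B[OF f_mem[OF that]] by simp
  have "\<bar>sup_conv n x\<bar> \<le> B" if "x \<in> X" for x n
  proof -
    have "sup_conv n x \<le> B"
    proof (rule sup_conv_least[OF ne])
      fix w assume "w \<in> E"
      then have "snd w \<le> B" using B[of w] by simp
      moreover have "0 \<le> real n * dist x (fst w)" by simp
      ultimately show "snd w - real n * dist x (fst w) \<le> B" by linarith
    qed
    then show ?thesis using sup_conv_ge[OF that, of n] f[OF that] by simp
  qed
  with f that show ?thesis by blast
qed

end

section \<open>The scaled Lebesgue measure on the box\<close>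

lemma Delta_eq_cbox: "Delta = cbox (\<chi> i. - 1) (\<chi> i. 1)"
  by (auto simp: Delta_def mem_box_cart)

lemma compact_Delta: "compact Delta"
  by (simp add: Delta_eq_cbox)

lemma Delta_nonempty: "Delta \<noteq> {}"
  by (auto simp: Delta_def intro!: exI[of _ 0])

lemma space_lam [simp]: "space lam = Delta"
  by (simp add: lam_def space_scale_measure)

lemma sets_lam: "sets lam = sets (lebesgue_on Delta)"
  by (simp add: lam_def)

lemma finite_measure_lam: "finite_measure (lam :: (real ^ 'n) measure)"
proof (rule finite_measureI)
  have "emeasure lebesgue (Delta :: (real ^ 'n) set) < \<infinity>"
    using lmeasurable_compact[OF compact_Delta] by (auto simp: fmeasurable_def)
  then show "emeasure (lam :: (real ^ 'n) measure) (space lam) \<noteq> \<infinity>"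
    by (simp add: lam_def space_scale_measure emeasure_restrict_space ennreal_mult_eq_top_iff Delta_eq_cbox)
qed

lemma closed_sets_lam: "closed S \<Longrightarrow> S \<subseteq> Delta \<Longrightarrow> S \<in> sets lam"
  by (simp add: sets_lam sets_restrict_space_iff Delta_eq_cbox)

lemma continuous_measurable_lam:
  fixes h :: "real ^ 'n \<Rightarrow> real"
  assumes "continuous_on Delta h"
  shows "h \<in> borel_measurable lam"
  unfolding measurable_cong_sets[OF sets_lam refl]
  by (rule continuous_imp_measurable_on_sets_lebesgue[OF assms]) (simp add: Delta_eq_cbox)

lemma integrable_lam_bounded:
  fixes h :: "real ^ 'n \<Rightarrow> real"
  assumes "h \<in> borel_measurable lam" "\<And>x. x \<in> Delta \<Longrightarrow> \<bar>h x\<bar> \<le> B"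
  shows "integrable lam h"
  using assms by (intro finite_measure.integrable_const_bound[OF finite_measure_lam, of _ B]) auto

lemma integrable_lam_continuous:
  fixes h :: "real ^ 'n \<Rightarrow> real"
  assumes "continuous_on Delta h"
  shows "integrable lam h"
proof -
  have "bounded (h ` Delta)"
    by (intro compact_imp_bounded compact_continuous_image assms compact_Delta)
  then obtain B where "\<And>x. x \<in> Delta \<Longrightarrow> \<bar>h x\<bar> \<le> B" unfolding bounded_iff by auto
  then show ?thesis by (rule integrable_lam_bounded[OF continuous_measurable_lam[OF assms]])
qed

lemma continuous_on_eval_vec: "continuous_on S (\<lambda>x. eval f (($) x))"
  by (intro continuous_intros)

lemma integrable_lam_eval: "integrable lam (\<lambda>x. eval f (($) x))"
  by (rule integrable_lam_continuous[OF continuous_on_eval_vec])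

text \<open>The bridge from polynomial functions, in which Stone-Weierstrass is stated, to formal
  polynomials; a linear functional is given by its values on the standard basis.\<close>

lemma real_polynomial_function_eval:
  fixes h :: "real ^ 'n \<Rightarrow> real"
  assumes "real_polynomial_function h"
  shows "\<exists>f. \<forall>x. eval f (($) x) = h x"
  using assms
proof (induction rule: real_polynomial_function.induct)
  case (linear h)
  then interpret bounded_linear h .
  have "eval (\<Sum>i\<in>UNIV. Const (h (axis i 1)) * Var i) (($) x) = h x" for x :: "real ^ 'n"
  proof -
    have "h x = h (\<Sum>i\<in>UNIV. x $ i *\<^sub>R axis i 1)"
      using basis_expansion[of x] by (simp add: scalar_mult_eq_scaleR)
    also have "\<dots> = (\<Sum>i\<in>UNIV. x $ i * h (axis i 1))"
      by (simp add: sum scaleR)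
    finally show ?thesis by (simp add: eval_simps mult.commute)
  qed
  then show ?case by blast
next
  case (const c)
  show ?case by (intro exI[of _ "Const c"]) simp
next
  case (add h h')
  then obtain f f' where "\<forall>x. eval f (($) x) = h x" "\<forall>x. eval f' (($) x) = h' x" by blast
  then show ?case by (intro exI[of _ "f + f'"]) (simp add: eval_simps)
next
  case (mult h h')
  then obtain f f' where "\<forall>x. eval f (($) x) = h x" "\<forall>x. eval f' (($) x) = h' x" by blast
  then show ?case by (intro exI[of _ "f * f'"]) (simp add: eval_simps)
qed

lemma Stone_Weierstrass_eval:
  fixes h :: "real ^ 'n \<Rightarrow> real"
  assumes "compact S" "continuous_on S h" "0 < e"
  obtains f where "\<And>x. x \<in> S \<Longrightarrow> \<bar>h x - eval f (($) x)\<bar> < e"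
  using Stone_Weierstrass_real_polynomial_function[OF assms] real_polynomial_function_eval by metis

lemma section_max_integrable:
  fixes f :: "real ^ 'n \<Rightarrow> real"
  assumes "compact_section_max Delta E f"
  shows "integrable lam f"
proof -
  interpret compact_section_max Delta E f by fact
  have "f \<in> borel_measurable lam"
    by (rule borel_measurableI_ge) (use closed_sets_lam closed_superlevel in auto)
  then show ?thesis
    using sup_conv_bounded[OF Delta_nonempty] integrable_lam_bounded by metis
qed

lemma section_max_polynomial_approx:
  fixes f :: "real ^ 'n \<Rightarrow> real"
  assumes "compact_section_max Delta E f" "0 < e"
  obtains \<phi> where "\<And>x. x \<in> Delta \<Longrightarrow> f x < eval \<phi> (($) x)"
    "(\<integral>x. eval \<phi> (($) x) \<partial>lam) \<le> (\<integral>x. f x \<partial>lam) + e"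
proof -
  interpret compact_section_max Delta E f by fact
  interpret lam: finite_measure "lam :: (real ^ 'n) measure" by (rule finite_measure_lam)
  have ne: "E \<noteq> {}" using f_mem Delta_nonempty by blast
  obtain B where B: "\<And>x. x \<in> Delta \<Longrightarrow> \<bar>f x\<bar> \<le> B" "\<And>x n. x \<in> Delta \<Longrightarrow> \<bar>sup_conv n x\<bar> \<le> B"
    using sup_conv_bounded[OF Delta_nonempty] by metis
  have f_int: "integrable lam f" by (rule section_max_integrable) fact
  have cont: "continuous_on Delta (sup_conv n)" for n
    by (rule continuous_on_sup_conv[OF ne])
  have "(\<lambda>n. \<integral>x. sup_conv n x \<partial>lam) \<longlonglongrightarrow> (\<integral>x. f x \<partial>lam)"
  proof (rule integral_dominated_convergence[where w = "\<lambda>_. B"])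
    show "f \<in> borel_measurable lam" using f_int by simp
    show "sup_conv n \<in> borel_measurable lam" for n
      by (rule continuous_measurable_lam[OF cont])
  qed (use sup_conv_tendsto B in auto)
  then have "\<forall>\<^sub>F n in sequentially. (\<integral>x. sup_conv n x \<partial>lam) < (\<integral>x. f x \<partial>lam) + e / 2"
    by (rule order_tendstoD) (use \<open>0 < e\<close> in simp)
  then obtain n where n: "(\<integral>x. sup_conv n x \<partial>lam) < (\<integral>x. f x \<partial>lam) + e / 2"
    by (auto simp: eventually_sequentially)
  define V where "V = measure lam (Delta :: (real ^ 'n) set)"
  \<comment> \<open>Chosen so that an error of \<open>3 * d\<close> costs at most
    \<open>e / 2\<close> in the integral; \<open>V + 1\<close> avoids dividing by 0.\<close>
  define d where "d = e / (6 * (V + 1))"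
  have "0 \<le> V" by (simp add: V_def)
  with \<open>0 < e\<close> have "0 < d" by (simp add: d_def)
  have "d * 3 * V \<le> e / 2"
    using \<open>0 \<le> V\<close> \<open>0 < e\<close> by (simp add: d_def divide_simps)
  \<comment> \<open>Shifting by \<open>2 * d\<close> and approximating within \<open>d\<close> puts
    the polynomial strictly between \<open>sup_conv n x + d\<close> and
    \<open>sup_conv n x + 3 * d\<close>, hence above \<open>f\<close>.\<close>
  have "continuous_on Delta (\<lambda>x. sup_conv n x + 2 * d)"
    by (intro continuous_intros cont)
  from Stone_Weierstrass_eval[OF compact_Delta this \<open>0 < d\<close>]
  obtain \<phi> where \<phi>: "\<And>x. x \<in> Delta \<Longrightarrow> \<bar>(sup_conv n x + 2 * d) - eval \<phi> (($) x)\<bar> < d"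
    by blast
  have int: "integrable lam (sup_conv n)" by (rule integrable_lam_continuous[OF cont])
  have "(\<integral>x. eval \<phi> (($) x) \<partial>lam) \<le> (\<integral>x. sup_conv n x + 3 * d \<partial>lam)"
  proof (rule integral_mono)
    fix x :: "real ^ 'n" assume "x \<in> space lam"
    then show "eval \<phi> (($) x) \<le> sup_conv n x + 3 * d" using \<phi>[of x] by auto
  qed (use integrable_lam_eval int in auto)
  also have "\<dots> = (\<integral>x. sup_conv n x \<partial>lam) + 3 * d * V"
    using int by (simp add: V_def)
  also have "\<dots> \<le> (\<integral>x. f x \<partial>lam) + e"
    using n \<open>d * 3 * V \<le> e / 2\<close> by simp
  finally have "(\<integral>x. eval \<phi> (($) x) \<partial>lam) \<le> (\<integral>x. f x \<partial>lam) + e" .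
  moreover have "f x < eval \<phi> (($) x)" if "x \<in> Delta" for x
    using \<phi>[OF that] sup_conv_ge[OF that, of n] \<open>0 < d\<close> by linarith
  ultimately show ?thesis using that by blast
qed

section \<open>The hierarchy\<close>

definition xyz_point :: "real ^ 'n \<Rightarrow> real ^ 'n \<Rightarrow> real \<Rightarrow> 'n xyz \<Rightarrow> real" where
  "xyz_point x y z = case_xyz (($) x) (($) y) z"

lemma xyz_point_simps [simp]:
  "xyz_point x y z (XV i) = x $ i" "xyz_point x y z (YV i) = y $ i" "xyz_point x y z ZV = z"
  by (simp_all add: xyz_point_def)

lemma eval_xyz_point [simp]:
  "eval (in_x f) (xyz_point x y z) = eval f (($) x)"
  "eval (in_y f) (xyz_point x y z) = eval f (($) y)"
  by (simp_all add: eval_subst)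

text \<open>The Positivstellensatz speaks of arbitrary assignments; this turns them into triples of
  vectors and a number.\<close>

lemma xyz_point_surj:
  obtains x y :: "real ^ 'n" and z where "a = xyz_point x y z"
proof
  show "a = xyz_point (\<chi> i. a (XV i)) (\<chi> i. a (YV i)) (a ZV)"
  proof
    show "a v = xyz_point (\<chi> i. a (XV i)) (\<chi> i. a (YV i)) (a ZV) v" for v
      by (cases v) simp_all
  qed
qed

lemma finite_hindices: "finite (hindices m r)"
  by (simp add: hindices_def)

lemma one_minus_square_nonneg_iff: "0 \<le> 1 - u ^ 2 \<longleftrightarrow> - 1 \<le> u \<and> u \<le> (1 :: real)"
  using abs_square_le_1[of u] by (auto simp: abs_le_iff)

text \<open>\<open>0 \<le> D\<close> lets \<open>H4\<close> express the interval for
  \<open>z\<close>; the inclusion in \<open>Delta\<close> accounts for the constraints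
  \<open>H2'\<close> on \<open>y\<close>, which \<open>psi_feasible\<close> does not
  mention.\<close>

lemma hpoly_nonneg_iff:
  assumes "0 \<le> D" "Omega g r \<subseteq> Delta"
  shows "(\<forall>c\<in>hindices m r. 0 \<le> eval (hpoly p q g D c) (xyz_point x y z)) \<longleftrightarrow>
    x \<in> Delta \<and> (y, z) \<in> psi_feasible p q m g r D x"
proof -
  have z: "0 \<le> D ^ 2 - z ^ 2 \<longleftrightarrow> z \<in> {- D..D}"
    using power2_le_iff_abs_le[OF assms(1), of z] by (auto simp: abs_le_iff)
  have "(\<forall>c\<in>hindices m r. 0 \<le> eval (hpoly p q g D c) (xyz_point x y z)) \<longleftrightarrow>
      (\<forall>i\<in>{1..m}. 0 \<le> eval (p i) (($) x) * eval (q i) (($) y)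
                         - eval (p i) (($) y) * eval (q i) (($) x)
                         - z * eval (q i) (($) x) * eval (q i) (($) y)) \<and>
      y \<in> Omega g r \<and> y \<in> Delta \<and> x \<in> Delta \<and> z \<in> {- D..D}"
    unfolding z[symmetric]
    by (simp add: hindices_def ball_Un Omega_def Delta_def eval_simps one_minus_square_nonneg_iff
        del: diff_ge_0_iff_ge) blast
  then show ?thesis
    using assms(2) by (auto simp: psi_feasible_def)
qed

text \<open>The generators \<open>H3\<close>, \<open>H2'\<close> and \<open>H4\<close> are
  themselves bounds on the squares of the three kinds of variables.\<close>

lemma archimedean_hpoly: "archimedean (generated_module (hindices m r) (hpoly p q g D))"
proof (rule archimedeanI[OF quadratic_module_generated])
  have mem: "hpoly p q g D c \<in> generated_module (hindices m r) (hpoly p q g D)"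
    if "c \<in> hindices m r" for c
    by (rule generator_in_generated_module[OF finite_hindices that])
  fix v :: "'a xyz"
  show "\<exists>N. Const N - Var v ^ 2 \<in> generated_module (hindices m r) (hpoly p q g D)"
  proof (cases v)
    case (XV i)
    then show ?thesis
      using mem[of "H3 i"] by (intro exI[of _ 1]) (simp add: hindices_def)
  next
    case (YV i)
    then show ?thesis
      using mem[of "H2' i"] by (intro exI[of _ 1]) (simp add: hindices_def)
  next
    case ZV
    then show ?thesis
      using mem[of H4] by (intro exI[of _ "D ^ 2"]) (simp add: hindices_def)
  qed
qed

section \<open>The value function and the convergence of the hierarchy\<close>

locale parametric_problem =
  fixes p q g :: "nat \<Rightarrow> 'n::finite rpoly" and m r :: nat and D :: real
  assumes compact_Omega: "compact (Omega g r)"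
    and Omega_subset: "Omega g r \<subseteq> Delta"
    and feasible_nonempty: "\<And>x. x \<in> Delta \<Longrightarrow> psi_feasible p q m g r D x \<noteq> {}"
begin

abbreviation "feasible \<equiv> psi_feasible p q m g r D"
abbreviation "\<psi> \<equiv> psi_tilde p q m g r D"

text \<open>It contains all feasible values over \<open>x\<close>, with \<open>y\<close> projected
  away; only its topmost points form the graph of \<open>\<psi>\<close>.\<close>

definition graph :: "((real ^ 'n) \<times> real) set" where
  "graph = {(x, z). x \<in> Delta \<and> (\<exists>y. (y, z) \<in> feasible x)}"

text \<open>Some feasible \<open>z\<close> lies in \<open>{- D..D}\<close>, so this interval is
  nonempty.\<close>

lemma D_nonneg: "0 \<le> D"
proof -
  obtain x :: "real ^ 'n" where "x \<in> Delta" using Delta_nonempty by blast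
  then show ?thesis using feasible_nonempty[of x] by (auto simp: psi_feasible_def)
qed

lemma compact_graph: "compact graph"
proof -
  define G where "G i w = (case w of (x, y, z) \<Rightarrow>
     eval (p i) (($) x) * eval (q i) (($) y) - eval (p i) (($) y) * eval (q i) (($) x)
       - z * eval (q i) (($) x) * eval (q i) (($) y))"
    for i and w :: "(real ^ 'n) \<times> (real ^ 'n) \<times> real"
  define F where "F = (Delta \<times> Omega g r \<times> {- D..D}) \<inter> (\<Inter>i\<in>{1..m}. {w. 0 \<le> G i w})"
  have "continuous_on UNIV (G i)" for i
    unfolding G_def case_prod_beta by (intro continuous_intros)
  then have "closed {w. 0 \<le> G i w}" for i
    by (intro closed_Collect_le continuous_on_const)
  then have "compact F"
    unfolding F_def
    by (intro compact_Int_closed compact_Times compact_Delta compact_Omega compact_Icc closed_INT) auto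
  then have "compact ((\<lambda>w. (fst w, snd (snd w))) ` F)"
    by (intro compact_continuous_image continuous_intros)
  also have "(\<lambda>w. (fst w, snd (snd w))) ` F = graph"
  proof -
    have "(x, y, z) \<in> F \<longleftrightarrow> x \<in> Delta \<and> (y, z) \<in> feasible x" for x y z
      by (auto simp: F_def G_def psi_feasible_def)
    then show ?thesis by (force simp: graph_def)
  qed
  finally show ?thesis .
qed

text \<open>\<open>GREATEST\<close> has the expected meaning only if a maximum exists; it does,
  because the section of \<open>graph\<close> over \<open>x\<close> is compact and nonempty.\<close>

lemma psi_tilde_greatest:
  assumes x: "x \<in> Delta"
  shows "\<exists>y. (y, \<psi> x) \<in> feasible x" and "(y, z) \<in> feasible x \<Longrightarrow> z \<le> \<psi> x"
proof -
  let ?S = "snd ` (graph \<inter> ({x} \<times> UNIV))"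
  have S: "z \<in> ?S \<longleftrightarrow> (\<exists>y. (y, z) \<in> feasible x)" for z
    using x by (force simp: graph_def)
  have "compact ?S"
    by (intro compact_continuous_image compact_Int_closed compact_graph closed_Times continuous_intros)
  moreover have "?S \<noteq> {}"
    using feasible_nonempty[OF x] S by fastforce
  ultimately obtain s where s: "s \<in> ?S" "\<forall>t\<in>?S. t \<le> s"
    using compact_attains_sup by blast
  have "\<psi> x = s"
    unfolding psi_tilde_def using s unfolding S by (intro Greatest_equality) (use s(2) S in blast)+
  then show "\<exists>y. (y, \<psi> x) \<in> feasible x" "(y, z) \<in> feasible x \<Longrightarrow> z \<le> \<psi> x"
    using s S by blast+
qed

sublocale section_max: compact_section_max Delta graph \<psi>
  by unfold_locales (use compact_graph psi_tilde_greatest in \<open>auto simp: graph_def\<close>)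

lemma integrable_psi: "integrable lam \<psi>"
  by (rule section_max_integrable[OF section_max.compact_section_max_axioms])

lemma sos_feasible_upper_bound:
  assumes "(\<phi>, \<sigma>0, \<sigma>) \<in> sos_feasible p q m g r D k" "x \<in> Delta"
  shows "\<psi> x \<le> eval \<phi> (($) x)"
proof -
  \<comment> \<open>At a point \<open>y\<close> attaining the maximum every \<open>hpoly\<close> is
    nonnegative, and so is the right-hand side of the identity.\<close>
  obtain y where "(y, \<psi> x) \<in> feasible x" using psi_tilde_greatest(1)[OF assms(2)] by blast
  let ?a = "xyz_point x y (\<psi> x)"
  have h: "0 \<le> eval (hpoly p q g D c) ?a" if "c \<in> hindices m r" for c
    using hpoly_nonneg_iff[OF D_nonneg Omega_subset] assms(2) \<open>(y, \<psi> x) \<in> feasible x\<close> that by blast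
  have id: "in_x \<phi> - Var ZV = \<sigma>0 + (\<Sum>c\<in>hindices m r. \<sigma> c * hpoly p q g D c)"
    and sos: "\<sigma>0 \<in> sos" "\<And>c. c \<in> hindices m r \<Longrightarrow> \<sigma> c \<in> sos"
    using assms(1) by (auto simp: sos_feasible_def)
  have "eval \<phi> (($) x) - \<psi> x = eval (in_x \<phi> - Var ZV) ?a"
    by (simp add: eval_diff)
  also have "\<dots> = eval \<sigma>0 ?a + (\<Sum>c\<in>hindices m r. eval (\<sigma> c) ?a * eval (hpoly p q g D c) ?a)"
    unfolding id by (simp add: eval_simps)
  also have "\<dots> \<ge> 0"
    by (intro add_nonneg_nonneg sum_nonneg mult_nonneg_nonneg[OF eval_sos_nonneg h] eval_sos_nonneg sos)
  finally show ?thesis by simp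
qed

text \<open>The Positivstellensatz gives a certificate without degree bounds; this single
  certificate fits every \<open>k\<close> that exceeds all of its degrees.\<close>

lemma sos_feasible_eventually:
  assumes "\<And>x. x \<in> Delta \<Longrightarrow> \<psi> x < eval \<phi> (($) x)"
  obtains \<sigma>0 \<sigma> where "\<forall>\<^sub>F k in sequentially. (\<phi>, \<sigma>0, \<sigma>) \<in> sos_feasible p q m g r D k"
proof -
  let ?C = "hindices m r" and ?h = "hpoly p q g D"
  have "in_x \<phi> - Var ZV \<in> generated_module ?C ?h"
  proof (rule archimedean_positivstellensatz[OF quadratic_module_generated archimedean_hpoly])
    fix a :: "'n xyz \<Rightarrow> real"
    assume a: "\<forall>h\<in>generated_module ?C ?h. 0 \<le> eval h a"
    obtain x y z where xyz: "a = xyz_point x y z" by (rule xyz_point_surj)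
    have "\<forall>c\<in>?C. 0 \<le> eval (?h c) (xyz_point x y z)"
      using a generator_in_generated_module[OF finite_hindices] unfolding xyz by blast
    then have "x \<in> Delta" "(y, z) \<in> feasible x"
      using hpoly_nonneg_iff[OF D_nonneg Omega_subset] by blast+
    then show "0 < eval (in_x \<phi> - Var ZV) a"
      using assms[of x] psi_tilde_greatest(2)[of x y z] by (simp add: eval_diff xyz)
  qed
  then obtain s0 s where s: "in_x \<phi> - Var ZV = s0 + (\<Sum>c\<in>?C. s c * ?h c)"
      "s0 \<in> sos" "\<And>c. c \<in> ?C \<Longrightarrow> s c \<in> sos"
    by (rule generated_moduleE) blast
  \<comment> \<open>The sum dominates each single degree, and \<open>K \<le> k\<close> implies
    \<open>K \<le> 2 * k\<close>.\<close>
  define K where "K = deg \<phi> + deg s0 + (\<Sum>c\<in>?C. deg (s c * ?h c))"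
  have "(\<phi>, s0, s) \<in> sos_feasible p q m g r D k" if "K \<le> k" for k
  proof -
    have "deg (s c * ?h c) \<le> (\<Sum>c\<in>?C. deg (s c * ?h c))" if "c \<in> ?C" for c
      by (rule member_le_sum) (use that finite_hindices in auto)
    then have "deg (s c * ?h c) \<le> 2 * k" if "c \<in> ?C" for c
      using that \<open>K \<le> k\<close> unfolding K_def by fastforce
    moreover have "deg \<phi> \<le> 2 * k" "deg s0 \<le> 2 * k"
      using \<open>K \<le> k\<close> by (auto simp: K_def)
    ultimately show ?thesis using s by (auto simp: sos_feasible_def)
  qed
  then show ?thesis
    by (intro that[of s0 s] eventually_sequentiallyI[of K])
qed

text \<open>This holds for every \<open>k\<close>: where no tuple is feasible, the infimum is
  \<infinity>.\<close>

lemma rho_ge: "ereal (\<integral>x. \<psi> x \<partial>lam) \<le> rho p q m g r D k"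
  unfolding rho_def
proof (rule INF_greatest)
  fix t assume t: "t \<in> sos_feasible p q m g r D k"
  obtain \<phi> \<sigma>0 \<sigma> where eq: "t = (\<phi>, \<sigma>0, \<sigma>)" by (cases t)
  have "(\<integral>x. \<psi> x \<partial>lam) \<le> (\<integral>x. eval \<phi> (($) x) \<partial>lam)"
    using sos_feasible_upper_bound[OF t[unfolded eq]]
    by (intro integral_mono integrable_psi integrable_lam_eval) simp
  then show "ereal (\<integral>x. \<psi> x \<partial>lam) \<le>
      (case t of (\<phi>, \<sigma>0, \<sigma>) \<Rightarrow> ereal (\<integral>x. eval \<phi> (($) x) \<partial>lam))"
    by (simp add: eq)
qed

lemma rho_eventually_le:
  assumes "0 < e"
  shows "\<forall>\<^sub>F k in sequentially. rho p q m g r D k \<le> ereal ((\<integral>x. \<psi> x \<partial>lam) + e)"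
proof -
  obtain \<phi> where \<phi>: "\<And>x. x \<in> Delta \<Longrightarrow> \<psi> x < eval \<phi> (($) x)"
      "(\<integral>x. eval \<phi> (($) x) \<partial>lam) \<le> (\<integral>x. \<psi> x \<partial>lam) + e"
    using section_max_polynomial_approx[OF section_max.compact_section_max_axioms assms] by blast
  obtain \<sigma>0 \<sigma> where "\<forall>\<^sub>F k in sequentially. (\<phi>, \<sigma>0, \<sigma>) \<in> sos_feasible p q m g r D k"
    using sos_feasible_eventually[OF \<phi>(1)] by blast
  then show ?thesis
  proof eventually_elim
    case (elim k)
    show ?case unfolding rho_def by (rule INF_lower2[OF elim]) (use \<phi>(2) in simp)
  qed
qed

lemma rho_tendsto: "rho p q m g r D \<longlonglongrightarrow> ereal (\<integral>x. \<psi> x \<partial>lam)"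
proof (rule order_tendstoI)
  fix a assume "a < ereal (\<integral>x. \<psi> x \<partial>lam)"
  then show "\<forall>\<^sub>F k in sequentially. a < rho p q m g r D k"
    using rho_ge less_le_trans by (intro always_eventually) blast
next
  fix a assume "ereal (\<integral>x. \<psi> x \<partial>lam) < a"
  then obtain b where b: "ereal (\<integral>x. \<psi> x \<partial>lam) < ereal b" "ereal b < a"
    using ereal_dense2 by blast
  then have "\<forall>\<^sub>F k in sequentially. rho p q m g r D k \<le> ereal b"
    using rho_eventually_le[of "b - (\<integral>x. \<psi> x \<partial>lam)"] by simp
  then show "\<forall>\<^sub>F k in sequentially. rho p q m g r D k < a"
    by eventually_elim (use b(2) in order)
qed

text \<open>Since \<open>\<phi> k\<close> lies above \<open>\<psi>\<close>, the absolute value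
  disappears and the L1 distance is a difference of integrals, squeezed between 0 and
  \<open>rho\<close> plus the tolerance minus the limit.\<close>

lemma nearly_optimal_tendsto:
  assumes feas: "\<And>k. k0 \<le> k \<Longrightarrow> (\<phi> k, \<sigma>0 k, \<sigma> k) \<in> sos_feasible p q m g r D k"
    and opt: "\<And>k. k0 \<le> k \<Longrightarrow>
      ereal (\<integral>x. eval (\<phi> k) (($) x) \<partial>lam) \<le> rho p q m g r D k + ereal (\<epsilon> k)"
    and eps: "\<epsilon> \<longlonglongrightarrow> 0"
  shows "(\<lambda>k. \<integral>x. \<bar>eval (\<phi> k) (($) x) - \<psi> x\<bar> \<partial>lam) \<longlonglongrightarrow> 0"
proof -
  let ?I = "\<integral>x. \<psi> x \<partial>lam" and ?J = "\<lambda>k. \<integral>x. eval (\<phi> k) (($) x) \<partial>lam"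
  have dist: "(\<integral>x. \<bar>eval (\<phi> k) (($) x) - \<psi> x\<bar> \<partial>lam) = ?J k - ?I" if "k0 \<le> k" for k
  proof -
    have "(\<integral>x. \<bar>eval (\<phi> k) (($) x) - \<psi> x\<bar> \<partial>lam) = (\<integral>x. eval (\<phi> k) (($) x) - \<psi> x \<partial>lam)"
      using sos_feasible_upper_bound[OF feas[OF that]] by (intro Bochner_Integration.integral_cong) auto
    then show ?thesis by (simp add: integrable_psi integrable_lam_eval)
  qed
  \<comment> \<open>Both limits are finite, so extended real addition is continuous there.\<close>
  have "(\<lambda>k. rho p q m g r D k + ereal (\<epsilon> k)) \<longlonglongrightarrow> ereal ?I + ereal 0"
    by (intro tendsto_add_ereal rho_tendsto tendsto_ereal eps) auto
  moreover have "\<forall>\<^sub>F k in sequentially. ereal (?J k) \<le> rho p q m g r D k + ereal (\<epsilon> k)"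
    using opt by (auto intro: eventually_sequentiallyI)
  moreover have "\<forall>\<^sub>F k in sequentially. ereal ?I \<le> ereal (?J k)"
    using sos_feasible_upper_bound[OF feas]
    by (auto intro!: eventually_sequentiallyI[of k0] integral_mono integrable_psi integrable_lam_eval)
  ultimately have "(\<lambda>k. ereal (?J k)) \<longlonglongrightarrow> ereal ?I"
    using tendsto_sandwich[of "\<lambda>_. ereal ?I" "\<lambda>k. ereal (?J k)" sequentially _ "ereal ?I"] by simp
  then have "(\<lambda>k. ?J k - ?I) \<longlonglongrightarrow> 0"
    using LIM_zero by auto
  then show ?thesis
    by (rule Lim_transform_eventually) (use dist in \<open>auto intro!: eventually_sequentiallyI[of k0]\<close>)
qed

end

text \<open>The tolerance \<open>\<epsilon>\<close> is an arbitrary null sequence, of which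
  \<open>1 / k\<close> is an instance.\<close>

theorem theorem4p2:
  fixes p q g :: "nat \<Rightarrow> 'n::finite rpoly"
    and m r :: nat
    and flow fupp :: "nat \<Rightarrow> real"
    and D :: real
  assumes "1 \<le> m"
    and "\<And>i. i \<in> {1..m} \<Longrightarrow> certified g r (p i - Const (flow i) * q i)"
    and "\<And>i. i \<in> {1..m} \<Longrightarrow> certified g r (Const (fupp i) * q i - p i)"
    and "D = Max (fupp ` {1..m}) - Min (flow ` {1..m})"
    and "Omega g r \<noteq> {}"
    and "compact (Omega g r)"
    and "Omega g r \<subseteq> Delta"
    and "\<And>i x. i \<in> {1..m} \<Longrightarrow> x \<in> Omega g r \<Longrightarrow> eval (q i) (($) x) > 0"
    and psi_tilde_well_defined:
        "\<And>x. x \<in> Delta \<Longrightarrow> psi_feasible p q m g r D x \<noteq> {}"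
  shows "integrable lam (psi_tilde p q m g r D) \<and>
    (rho p q m g r D \<longlongrightarrow> ereal (\<integral>x. psi_tilde p q m g r D x \<partial>lam)) sequentially \<and>
    (\<forall>\<psi> \<sigma>0 \<sigma> \<epsilon>.
       (\<forall>k\<ge>k_min p q m g r D.
          (\<psi> k, \<sigma>0 k, \<sigma> k) \<in> sos_feasible p q m g r D k \<and>
          ereal (\<integral>x. eval (\<psi> k) (($) x) \<partial>lam) \<le> rho p q m g r D k + ereal (\<epsilon> k)) \<and>
       \<epsilon> \<longlonglongrightarrow> 0 \<longrightarrow>
       (\<forall>k\<ge>k_min p q m g r D. \<forall>x\<in>Delta. psi_tilde p q m g r D x \<le> eval (\<psi> k) (($) x)) \<and>
       (\<lambda>k. \<integral>x. \<bar>eval (\<psi> k) (($) x) - psi_tilde p q m g r D x\<bar> \<partial>lam) \<longlonglongrightarrow> 0)"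


proof -
  interpret parametric_problem p q g m r D
    using assms(6,7) psi_tilde_well_defined by unfold_locales
  show ?thesis
  proof (intro conjI allI impI integrable_psi rho_tendsto ballI; elim conjE)
    fix \<phi> \<sigma>0 \<sigma> \<epsilon>
    assume opt: "\<forall>k\<ge>k_min p q m g r D.
        (\<phi> k, \<sigma>0 k, \<sigma> k) \<in> sos_feasible p q m g r D k \<and>
        ereal (\<integral>x. eval (\<phi> k) (($) x) \<partial>lam) \<le> rho p q m g r D k + ereal (\<epsilon> k)"
      and eps: "\<epsilon> \<longlonglongrightarrow> 0"
    show "\<psi> x \<le> eval (\<phi> k) (($) x)" if "k_min p q m g r D \<le> k" "x \<in> Delta" for k x
      using sos_feasible_upper_bound[OF _ that(2)] opt that(1) by blast
    show "(\<lambda>k. \<integral>x. \<bar>eval (\<phi> k) (($) x) - \<psi> x\<bar> \<partial>lam) \<longlonglongrightarrow> 0"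
      by (rule nearly_optimal_tendsto[OF _ _ eps]) (use opt in blast)+
  qed
qed

end
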